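(* Let $(\mathcal X,\mathcal X^\Omega)$, $(\mathcal Y,\mathcal Y^\Omega)$, $(\mathcal U,\mathcal U^\Omega)$, $(\mathcal Z,\mathcal Z^\Omega)$ be quasi-universal spaces. Then the composition $$\mathsf P(\mathcal X)^{\mathcal U}\times\mathsf P(\mathcal Y)^{\mathcal Z}\xrightarrow{\ \otimes\ }\mathsf P(\mathcal X\times\mathcal Y)^{\mathcal U\times\mathcal Z}\xrightarrow{\ \mathrm{swap}_*\ }\mathsf P(\mathcal Y\times\mathcal X)^{\mathcal U\times\mathcal Z}$$ equals the composition $$\mathsf P(\mathcal X)^{\mathcal U}\times\mathsf P(\mathcal Y)^{\mathcal Z}\xrightarrow{\mathrm{swap}}\mathsf P(\mathcal Y)^{\mathcal Z}\times\mathsf P(\mathcal X)^{\mathcal U}\xrightarrow{\ \otimes\ }\mathsf P(\mathcal Y\times\mathcal X)^{\mathcal Z\times\mathcal U}\xrightarrow{\mathrm{swap}^*}\mathsf P(\mathcal Y\times\mathcal X)^{\mathcal U\times\mathcal Z}.$$ More concretely, for $K(X|U)\in\mathsf P(\mathcal X)^{\mathcal U}$, $Q(Y|Z)\in\mathsf P(\mathcal Y)^{\mathcal Z}$, $u\in\mathcal U$, $z\in\mathcal Z$ and every quasi-measurable $f:\mathcal X\times\mathcal Y\to[0,\infty]$: $$\int\!\!\int f(x,y)\,K(X\in dx|U=u)\,Q(Y\in dy|Z=z)=\int\!\!\int f(x,y)\,Q(Y\in dy|Z=z)\,K(X\in dx|U=u).$$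
   Context: Fix the sample space: $\Omega=[0,1]^{\mathbb N}$, $\mathcal B_\Omega$ the $\sigma$-algebra of all universally measurable subsets of $\Omega$, $\Omega^\Omega$ the set of all measurable maps $(\Omega,\mathcal B_\Omega)\to(\Omega,\mathcal B_\Omega)$. A quasi-universal space is a pair $(\mathcal X,\mathcal X^\Omega)$ of a set and a set $\mathcal X^\Omega$ of maps $\Omega\to\mathcal X$ (admissible random variables) containing all constants and closed under $X\mapsto X\circ\Phi$, $\Phi\in\Omega^\Omega$; $g:\mathcal X\to\mathcal Y$ is quasi-measurable if $g\circ\mathcal X^\Omega\subseteq\mathcal Y^\Omega$; products carry componentwise structure; $[0,\infty]$ carries all $\mathcal B_\Omega$-Borel-measurable maps. The function space $\mathcal Y^{\mathcal X}$ is the set of quasi-measurable maps $\mathcal X\to\mathcal Y$, with admissible random variables the maps $Y:\Omega\to\mathcal Y^{\mathcal X}$ such that $(\omega,x)\mapsto Y(\omega)(x)$ is quasi-measurable. The induced $\sigma$-algebra is $\mathcal B_{\mathcal X}=\{A\subseteq\mathcal X\mid X^{-1}(A)\in\mathcal B_\Omega\ \forall X\in\mathcal X^\Omega\}$; $\mathcal B_{\mathcal X\times\mathcal Y}$ is that of the product. $\mathsf P(\mathcal X)$ is the quasi-universal space of push-forward measures $X_*P$ on $\mathcal B_{\mathcal X}$, with $X\in\mathcal X^\Omega$ and $P$ a probability measure on $(\Omega,\mathcal B_\Omega)$; its admissible random variables are the maps $\omega\mapsto X(\omega)_*P$ with $X\in(\mathcal X^\Omega)^\Omega$, $P$ a probability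 measure on $(\Omega,\mathcal B_\Omega)$. Elements of $\mathsf P(\mathcal X)^{\mathcal U}$ are called Markov kernels. $\otimes$ is the product of Markov kernels: $(K(X|U)\otimes Q(Y|Z))(D|u,z)=\int K(X\in D^y|U=u)\,Q(Y\in dy|Z=z)$ for $D\in\mathcal B_{\mathcal X\times\mathcal Y}$, $D^y=\{x\mid(x,y)\in D\}$. $\mathrm{swap}_*$ is push-forward along $(x,y)\mapsto(y,x)$, and $\mathrm{swap}^*$ is precomposition with $(u,z)\mapsto(z,u)$. *)

theory Defs
  imports "HOL-Probability.Probability"
begin

section \<open>The sample space\<close>

typedef cube = "{x :: nat \<Rightarrow> real. \<forall>i. x i \<in> {0..1}}"
  by (rule exI[of _ "\<lambda>_. 0"]) simp

text \<open>The Borel \<open>\<sigma>\<close>-algebra of the product topology, as the trace of the Borel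
  \<open>\<sigma>\<close>-algebra of \<^typ>\<open>nat \<Rightarrow> real\<close>.\<close>

definition cube_borel :: "cube measure" where
  "cube_borel = vimage_algebra UNIV Rep_cube borel"

definition universally_measurable :: "'a measure \<Rightarrow> 'a set set" where
  "universally_measurable M =
     {A. A \<subseteq> space M \<and>
         (\<forall>\<mu>. prob_space \<mu> \<and> sets \<mu> = sets M \<longrightarrow> A \<in> sets (completion \<mu>))}"

definition \<Omega> :: "cube measure" where
  "\<Omega> = sigma UNIV (universally_measurable cube_borel)"

lemma sigma_algebra_universally_measurable:
  "sigma_algebra (space M) (universally_measurable M)"
proof -
  let ?U = "universally_measurable M"
  have sub: "A \<subseteq> space M" if "A \<in> ?U" for A
    using that by (simp add: universally_measurable_def)
  have compl: "space M - A \<in> ?U" if "A \<in> ?U" for A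
  proof -
    have "space M - A \<in> sets (completion \<mu>)" if "prob_space \<mu>" "sets \<mu> = sets M" for \<mu>
    proof -
      have "A \<in> sets (completion \<mu>)"
        using \<open>A \<in> ?U\<close> that by (simp add: universally_measurable_def)
      then have "space (completion \<mu>) - A \<in> sets (completion \<mu>)"
        by (rule sets.compl_sets)
      then show ?thesis
        using sets_eq_imp_space_eq[OF that(2)] by (simp only: space_completion)
    qed
    then show ?thesis by (simp add: universally_measurable_def)
  qed
  have un: "(\<Union>i::nat. A i) \<in> ?U" if "range A \<subseteq> ?U" for A
  proof -
    have "(\<Union>i. A i) \<in> sets (completion \<mu>)" if "prob_space \<mu>" "sets \<mu> = sets M" for \<mu>
    proof -
      have "range A \<subseteq> sets (completion \<mu>)"
        using \<open>range A \<subseteq> ?U\<close> that unfolding universally_measurable_def by blast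
      then show ?thesis by (rule sets.countable_UN)
    qed
    moreover have "(\<Union>i. A i) \<subseteq> space M"
      using that sub by blast
    ultimately show ?thesis by (simp add: universally_measurable_def)
  qed
  have "{} \<in> ?U" by (simp add: universally_measurable_def)
  then show ?thesis
    unfolding sigma_algebra_iff2 using sub compl un by blast
qed

lemma space_Omega [simp]: "space \<Omega> = UNIV"
  by (simp add: \<Omega>_def space_measure_of_conv)

lemma sets_Omega: "sets \<Omega> = universally_measurable cube_borel"
  using sigma_algebra.sigma_sets_eq[OF sigma_algebra_universally_measurable[of cube_borel]]
  by (simp add: \<Omega>_def cube_borel_def sets_measure_of_conv universally_measurable_def)

definition cube_probs :: "cube measure set" where
  "cube_probs = {P. prob_space P \<and> sets P = sets \<Omega>}"


section \<open>Quasi-universal spaces\<close>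

datatype 'a qspace = QSpace (pts: "'a set") (rvs: "(cube \<Rightarrow> 'a) set")

definition quasi_universal :: "'a qspace \<Rightarrow> bool" where
  "quasi_universal X \<longleftrightarrow>
     (\<forall>f\<in>rvs X. range f \<subseteq> pts X) \<and>
     (\<forall>x\<in>pts X. (\<lambda>_. x) \<in> rvs X) \<and>
     (\<forall>f\<in>rvs X. \<forall>\<phi>\<in>\<Omega> \<rightarrow>\<^sub>M \<Omega>. f \<circ> \<phi> \<in> rvs X)"

text \<open>A map out of \<open>X\<close> is represented by its extension by \<^term>\<open>undefined\<close> outside
  \<^term>\<open>pts X\<close>, so that equality of HOL functions is equality of maps.\<close>

definition qmeas :: "'a qspace \<Rightarrow> 'b qspace \<Rightarrow> ('a \<Rightarrow> 'b) set"  (infixr "\<rightarrow>\<^sub>Q" 60) where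
  "X \<rightarrow>\<^sub>Q Y = {g \<in> pts X \<rightarrow>\<^sub>E pts Y. \<forall>f\<in>rvs X. g \<circ> f \<in> rvs Y}"

definition cube_space :: "cube qspace" where
  "cube_space = QSpace UNIV (\<Omega> \<rightarrow>\<^sub>M \<Omega>)"

definition ennreal_space :: "ennreal qspace" where
  "ennreal_space = QSpace UNIV (\<Omega> \<rightarrow>\<^sub>M borel)"

definition qprod :: "'a qspace \<Rightarrow> 'b qspace \<Rightarrow> ('a \<times> 'b) qspace"  (infixr "\<times>\<^sub>Q" 80) where
  "X \<times>\<^sub>Q Y = QSpace (pts X \<times> pts Y) {f. fst \<circ> f \<in> rvs X \<and> snd \<circ> f \<in> rvs Y}"

text \<open>The function space \<open>Y\<^sup>X\<close>.\<close>

definition qexp :: "'a qspace \<Rightarrow> 'b qspace \<Rightarrow> ('a \<Rightarrow> 'b) qspace"  (infixr "\<Rightarrow>\<^sub>Q" 70) where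
  "X \<Rightarrow>\<^sub>Q Y = QSpace (X \<rightarrow>\<^sub>Q Y)
     {F. range F \<subseteq> X \<rightarrow>\<^sub>Q Y \<and>
         (\<lambda>(\<omega>, x) \<in> UNIV \<times> pts X. F \<omega> x) \<in> cube_space \<times>\<^sub>Q X \<rightarrow>\<^sub>Q Y}"

definition induced :: "'a qspace \<Rightarrow> 'a measure" where
  "induced X = sigma (pts X) {A. A \<subseteq> pts X \<and> (\<forall>f\<in>rvs X. f -` A \<in> sets \<Omega>)}"

lemma space_induced [simp]: "space (induced X) = pts X"
  by (simp add: induced_def space_measure_of_conv)

lemma sets_induced:
  assumes "quasi_universal X"
  shows "sets (induced X) = {A. A \<subseteq> pts X \<and> (\<forall>f\<in>rvs X. f -` A \<in> sets \<Omega>)}" (is "_ = ?S")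
proof -
  have compl: "f -` (pts X - A) \<in> sets \<Omega>" if "f \<in> rvs X" "f -` A \<in> sets \<Omega>" for f A
  proof -
    have "f -` (pts X - A) = space \<Omega> - f -` A"
      using assms that(1) unfolding quasi_universal_def by fastforce
    then show ?thesis using that(2) by (metis sets.compl_sets)
  qed
  have "sigma_algebra (pts X) ?S"
    unfolding sigma_algebra_iff2 by (auto intro: compl simp: vimage_UN)
  then show ?thesis
    unfolding induced_def by (subst sets_measure_of) (auto simp: sigma_algebra.sigma_sets_eq)
qed


section \<open>Markov kernels\<close>

text \<open>\<open>cube_space \<Rightarrow>\<^sub>Q X\<close> is \<open>X\<^sup>\<Omega>\<close> as a quasi-universal space; its points are the admissible
  random variables of \<open>X\<close>.\<close>

definition qprob :: "'a qspace \<Rightarrow> 'a measure qspace" where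
  "qprob X = QSpace
     {distr P (induced X) f | P f. P \<in> cube_probs \<and> f \<in> rvs X}
     {\<lambda>\<omega>. distr P (induced X) (F \<omega>) | P F. P \<in> cube_probs \<and> F \<in> rvs (cube_space \<Rightarrow>\<^sub>Q X)}"

lemma pts_cube_space_qexp:
  assumes "quasi_universal X"
  shows "pts (cube_space \<Rightarrow>\<^sub>Q X) = rvs X"
proof -
  have "f \<in> rvs X" if "f \<in> cube_space \<rightarrow>\<^sub>Q X" for f
  proof -
    have "f \<circ> id \<in> rvs X"
      using that by (auto simp only: qmeas_def cube_space_def qspace.sel id_def intro!: measurable_ident_sets)
    then show ?thesis by simp
  qed
  moreover have "f \<in> cube_space \<rightarrow>\<^sub>Q X" if "f \<in> rvs X" for f
    using that assms
    by (auto simp: qmeas_def cube_space_def quasi_universal_def PiE_def extensional_def image_subset_iff)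
  ultimately show ?thesis by (auto simp: qexp_def)
qed

text \<open>If the set function below failed to be a measure, \<^const>\<open>measure_of\<close> would return the
  null measure, which is not a point of \<open>qprob (X \<times>\<^sub>Q Y)\<close>.\<close>

definition kernel_prod ::
  "'x qspace \<Rightarrow> 'y qspace \<Rightarrow> 'u qspace \<Rightarrow> 'z qspace \<Rightarrow>
   ('u \<Rightarrow> 'x measure) \<times> ('z \<Rightarrow> 'y measure) \<Rightarrow> 'u \<times> 'z \<Rightarrow> ('x \<times> 'y) measure" where
  "kernel_prod X Y U Z =
     (\<lambda>(K, Q) \<in> pts ((U \<Rightarrow>\<^sub>Q qprob X) \<times>\<^sub>Q (Z \<Rightarrow>\<^sub>Q qprob Y)).
      \<lambda>(u, z) \<in> pts (U \<times>\<^sub>Q Z).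
        measure_of (pts (X \<times>\<^sub>Q Y)) (sets (induced (X \<times>\<^sub>Q Y)))
          (\<lambda>D. \<integral>\<^sup>+ y. emeasure (K u) {x. (x, y) \<in> D} \<partial>Q z))"

definition swap_map :: "'a qspace \<Rightarrow> 'b qspace \<Rightarrow> 'a \<times> 'b \<Rightarrow> 'b \<times> 'a" where
  "swap_map X Y = (\<lambda>(x, y) \<in> pts (X \<times>\<^sub>Q Y). (y, x))"

text \<open>\<open>g\<^sub>*: P(X)\<^sup>W \<rightarrow> P(Y)\<^sup>W\<close> for \<open>g: X \<rightarrow> Y\<close>.\<close>

definition push_kernel ::
  "'w qspace \<Rightarrow> 'a qspace \<Rightarrow> 'b qspace \<Rightarrow> ('a \<Rightarrow> 'b) \<Rightarrow>
   ('w \<Rightarrow> 'a measure) \<Rightarrow> 'w \<Rightarrow> 'b measure" where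
  "push_kernel W X Y g =
     (\<lambda>L \<in> pts (W \<Rightarrow>\<^sub>Q qprob X). \<lambda>w \<in> pts W. distr (L w) (induced Y) g)"

text \<open>\<open>h\<^sup>*: T\<^sup>V \<rightarrow> T\<^sup>W\<close> for \<open>h: W \<rightarrow> V\<close>.\<close>

definition precomp ::
  "'w qspace \<Rightarrow> 'v qspace \<Rightarrow> 't qspace \<Rightarrow> ('w \<Rightarrow> 'v) \<Rightarrow> ('v \<Rightarrow> 't) \<Rightarrow> 'w \<Rightarrow> 't" where
  "precomp W V T h = (\<lambda>L \<in> pts (V \<Rightarrow>\<^sub>Q T). \<lambda>w \<in> pts W. L (h w))"

end

theory Submission
  imports Defs
begin

text \<open>
  Interleaving coordinates identifies \<open>\<Omega>\<close> with \<open>\<Omega> \<times> \<Omega>\<close> as Borel spaces. A quasi-measurable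
  function on \<open>\<Omega> \<times> \<Omega>\<close> therefore is a universally measurable function on the cube, so it agrees with a
  Borel function up to a null set of any given Borel product measure, and the classical Fubini theorem
  for that Borel function carries over. For push-forwards \<open>\<mu> = a\<^sub>*P\<close> and \<open>\<nu> = b\<^sub>*P'\<close> the iterated
  \<open>\<mu>\<close>-\<open>\<nu>\<close>-integrals are iterated \<open>P\<close>-\<open>P'\<close>-integrals over the cube, which gives Fubini for \<open>\<mu>\<close> and \<open>\<nu>\<close>.
  The same identification exhibits \<open>\<mu> \<otimes> \<nu>\<close> as the push-forward of one probability measure on the
  cube along an admissible random variable; as that measure depends on \<open>P\<close> and \<open>P'\<close> only, the product
  of two admissible random variables of measures is again admissible. By cartesian closedness
  this makes \<open>\<otimes>\<close> on kernels quasi-measurable.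
\<close>

section \<open>Universally measurable functions on the cube\<close>

definition cube_fst :: "cube \<Rightarrow> cube" where
  "cube_fst w = Abs_cube (\<lambda>i. Rep_cube w (2 * i))"

definition cube_snd :: "cube \<Rightarrow> cube" where
  "cube_snd w = Abs_cube (\<lambda>i. Rep_cube w (2 * i + 1))"

definition cube_pair :: "cube \<Rightarrow> cube \<Rightarrow> cube" where
  "cube_pair x y =
     Abs_cube (\<lambda>i. if even i then Rep_cube x (i div 2) else Rep_cube y (i div 2))"

lemma Rep_cube_bounds: "0 \<le> Rep_cube x i" "Rep_cube x i \<le> 1"
  using Rep_cube[of x] by auto

lemma Rep_cube_fst: "Rep_cube (cube_fst w) = (\<lambda>i. Rep_cube w (2 * i))"
  unfolding cube_fst_def by (rule Abs_cube_inverse) (simp add: Rep_cube_bounds)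

lemma Rep_cube_snd: "Rep_cube (cube_snd w) = (\<lambda>i. Rep_cube w (2 * i + 1))"
  unfolding cube_snd_def by (rule Abs_cube_inverse) (simp add: Rep_cube_bounds)

lemma Rep_cube_pair:
  "Rep_cube (cube_pair x y) =
     (\<lambda>i. if even i then Rep_cube x (i div 2) else Rep_cube y (i div 2))"
  unfolding cube_pair_def by (rule Abs_cube_inverse) (simp add: Rep_cube_bounds)

lemma cube_fst_pair [simp]: "cube_fst (cube_pair x y) = x"
  by (simp add: Rep_cube_inject[symmetric] Rep_cube_fst Rep_cube_pair)

lemma cube_snd_pair [simp]: "cube_snd (cube_pair x y) = y"
  by (simp add: Rep_cube_inject[symmetric] Rep_cube_snd Rep_cube_pair)

lemma space_cube_borel [simp]: "space cube_borel = UNIV"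
  by (simp add: cube_borel_def)

lemma measurable_Rep_cube [measurable]: "(\<lambda>x. Rep_cube x i) \<in> borel_measurable cube_borel"
proof -
  have "Rep_cube \<in> cube_borel \<rightarrow>\<^sub>M borel"
    unfolding cube_borel_def by (rule measurable_vimage_algebra1) simp
  then show ?thesis by (rule measurable_compose[OF _ measurable_product_coordinates])
qed

text \<open>The cube carries the trace of the Borel sigma-algebra of a countable product of copies
  of the reals, and that one is generated by the coordinates.\<close>

lemma measurable_cube_borelI:
  assumes "\<And>i. (\<lambda>x. Rep_cube (f x) i) \<in> borel_measurable M"
  shows "f \<in> M \<rightarrow>\<^sub>M cube_borel"
  unfolding cube_borel_def
  by (rule measurable_vimage_algebra2) (auto intro: measurable_coordinatewise_then_product assms)

lemma measurable_cube_fst [measurable]: "cube_fst \<in> cube_borel \<rightarrow>\<^sub>M cube_borel"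
  by (rule measurable_cube_borelI) (simp add: Rep_cube_fst)

lemma measurable_cube_snd [measurable]: "cube_snd \<in> cube_borel \<rightarrow>\<^sub>M cube_borel"
  by (rule measurable_cube_borelI) (simp add: Rep_cube_snd)

lemma measurable_cube_pair [measurable]:
  "(\<lambda>w. cube_pair (fst w) (snd w)) \<in> cube_borel \<Otimes>\<^sub>M cube_borel \<rightarrow>\<^sub>M cube_borel"
proof (rule measurable_cube_borelI)
  fix i
  show "(\<lambda>w. Rep_cube (cube_pair (fst w) (snd w)) i) \<in> borel_measurable (cube_borel \<Otimes>\<^sub>M cube_borel)"
    by (cases "even i") (simp_all add: Rep_cube_pair)
qed

section \<open>Universal measurability tested on Borel probabilities\<close>

definition cube_borel_probs :: "cube measure set" where
  "cube_borel_probs = {R. prob_space R \<and> sets R = sets cube_borel}"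

lemma cube_borel_probsD:
  assumes "R \<in> cube_borel_probs"
  shows "prob_space R" "sets R = sets cube_borel" "space R = UNIV"
  using assms sets_eq_imp_space_eq[of R cube_borel] by (auto simp: cube_borel_probs_def)

lemma cube_probsD:
  assumes "P \<in> cube_probs"
  shows "prob_space P" "sets P = sets \<Omega>" "space P = UNIV"
  using assms sets_eq_imp_space_eq[of P \<Omega>] by (auto simp: cube_probs_def)

lemma sets_Omega_iff:
  "A \<in> sets \<Omega> \<longleftrightarrow> (\<forall>R\<in>cube_borel_probs. A \<in> sets (completion R))"
  by (auto simp: sets_Omega universally_measurable_def cube_borel_probs_def)

text \<open>Every universally measurable set lies in the completion of each Borel probability
  \<open>R\<close>. Hence functions measurable on \<Omega> can be treated as functions on
  \<open>completion R\<close>, and \<open>R\<close> can be extended to \<Omega>.\<close>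

lemma measurable_id_completion_Omega:
  assumes "R \<in> cube_borel_probs"
  shows "(\<lambda>x. x) \<in> completion R \<rightarrow>\<^sub>M \<Omega>"
  by (rule measurableI) (use assms in \<open>auto simp: cube_borel_probsD sets_Omega_iff\<close>)

lemma measurable_id_Omega_cube_borel: "(\<lambda>x. x) \<in> \<Omega> \<rightarrow>\<^sub>M cube_borel"
proof (rule measurableI)
  fix A assume "A \<in> sets cube_borel"
  then show "(\<lambda>x. x) -` A \<inter> space \<Omega> \<in> sets \<Omega>"
    by (auto simp: sets_Omega_iff cube_borel_probsD)
qed simp

text \<open>To test a preimage under \<open>f\<close> against \<open>R\<close>, test the set itself
  against the push-forward of \<open>R\<close> along \<open>f\<close>. Its splitting into a Borel
  set and a part of a null set pulls back to such a splitting for \<open>R\<close>.\<close>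

lemma measurable_Omega_if_cube_borel:
  assumes f: "f \<in> cube_borel \<rightarrow>\<^sub>M cube_borel"
  shows "f \<in> \<Omega> \<rightarrow>\<^sub>M \<Omega>"
proof (rule measurableI)
  fix A assume A: "A \<in> sets \<Omega>"
  have "f -` A \<in> sets (completion R)" if R: "R \<in> cube_borel_probs" for R
  proof -
    interpret prob_space R using R by (rule cube_borel_probsD)
    have fR: "f \<in> R \<rightarrow>\<^sub>M cube_borel"
      using f cube_borel_probsD(2)[OF R] by (simp cong: measurable_cong_sets)
    have "distr R cube_borel f \<in> cube_borel_probs"
      by (simp add: cube_borel_probs_def prob_space_distr[OF fR])
    then have "A \<in> sets (completion (distr R cube_borel f))"
      using A by (simp add: sets_Omega_iff)
    then obtain S N N' where A_eq: "A = S \<union> N" and N: "N \<subseteq> N'"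
      "N' \<in> null_sets (distr R cube_borel f)" "S \<in> sets (distr R cube_borel f)"
      by (rule sets_completionE)
    show ?thesis
    proof (rule sets_completionI)
      show "f -` A = f -` S \<union> f -` N" "f -` N \<subseteq> f -` N'"
        using A_eq N by auto
      show "f -` N' \<in> null_sets R"
        using N fR by (simp add: null_sets_distr_iff cube_borel_probsD(3)[OF R])
      show "f -` S \<in> sets R"
        using N(3) measurable_sets[OF fR, of S] by (simp add: cube_borel_probsD(3)[OF R])
    qed
  qed
  then show "f -` A \<inter> space \<Omega> \<in> sets \<Omega>" by (simp add: sets_Omega_iff)
qed simp

lemma cube_fst_measurable_Omega: "cube_fst \<in> \<Omega> \<rightarrow>\<^sub>M \<Omega>"
  by (rule measurable_Omega_if_cube_borel[OF measurable_cube_fst])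

lemma cube_snd_measurable_Omega: "cube_snd \<in> \<Omega> \<rightarrow>\<^sub>M \<Omega>"
  by (rule measurable_Omega_if_cube_borel[OF measurable_cube_snd])

text \<open>Functions measurable for a completion have Borel versions. The version \<open>h'\<close>
  depends on the chosen \<open>R\<close>.\<close>

lemma Omega_measurable_ex_borel:
  fixes h :: "cube \<Rightarrow> ennreal"
  assumes "h \<in> borel_measurable \<Omega>" "R \<in> cube_borel_probs"
  shows "\<exists>h'\<in>borel_measurable cube_borel. AE x in R. h x = h' x"
proof -
  have "h \<in> borel_measurable (completion R)"
    using measurable_compose[OF measurable_id_completion_Omega[OF assms(2)] assms(1)] by simp
  then show ?thesis
    using completion_ex_borel_measurable cube_borel_probsD(2)[OF assms(2)]
    by (metis measurable_cong_sets)
qed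

text \<open>Converse of the preceding lemma: a Borel version for each \<open>R\<close> separately is
  enough, since universal measurability is tested one \<open>R\<close> at a time.\<close>

lemma Omega_measurable_if_AE_borel:
  fixes h :: "cube \<Rightarrow> ennreal"
  assumes *: "\<And>R. R \<in> cube_borel_probs \<Longrightarrow>
    \<exists>h'\<in>borel_measurable cube_borel. AE x in R. h x = h' x"
  shows "h \<in> borel_measurable \<Omega>"
proof (rule measurableI)
  fix B :: "ennreal set" assume B: "B \<in> sets borel"
  have "h -` B \<in> sets (completion R)" if R: "R \<in> cube_borel_probs" for R
  proof -
    from *[OF R] obtain h' where h': "h' \<in> borel_measurable cube_borel" "AE x in R. h x = h' x"
      by blast
    obtain N where N: "{x \<in> space R. h x \<noteq> h' x} \<subseteq> N" "N \<in> null_sets R"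
      using AE_E[OF h'(2)] by (metis null_setsI)
    show ?thesis
    proof (rule sets_completionI)
      \<comment> \<open>Off the null set \<open>N\<close> the two functions agree, so the preimage
        is a Borel set up to a subset of \<open>N\<close>.\<close>
      show "h -` B = (h' -` B - N) \<union> (h -` B \<inter> N)"
        using N(1) by (auto simp: cube_borel_probsD(3)[OF R])
      show "h' -` B - N \<in> sets R"
        using measurable_sets[OF h'(1) B] N(2) by (auto simp: cube_borel_probsD(2)[OF R])
    qed (use N in auto)
  qed
  then show "h -` B \<inter> space \<Omega> \<in> sets \<Omega>" by (simp add: sets_Omega_iff)
qed simp


section \<open>Iterated integrals over the cube\<close>

text \<open>Quasi-measurability of the uncurried map \<open>X \<times> Y \<rightarrow> [0,\<infinity>]\<close>, without the convention that maps
  are undefined off the product.\<close>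

definition jointly_measurable ::
  "'a qspace \<Rightarrow> 'b qspace \<Rightarrow> ('a \<Rightarrow> 'b \<Rightarrow> ennreal) \<Rightarrow> bool" where
  "jointly_measurable X Y F \<longleftrightarrow>
     (\<forall>a\<in>rvs X. \<forall>b\<in>rvs Y. (\<lambda>\<omega>. F (a \<omega>) (b \<omega>)) \<in> borel_measurable \<Omega>)"

lemma jointly_measurable_swap:
  "jointly_measurable X Y F \<Longrightarrow> jointly_measurable Y X (\<lambda>y x. F x y)"
  by (auto simp: jointly_measurable_def)

text \<open>The coordinate splittings are themselves admissible random variables, so joint
  measurability in two cube variables yields universal measurability in the single interleaved
  variable.\<close>

lemma jointly_measurable_cube_fst_snd:
  assumes "jointly_measurable cube_space cube_space g"
  shows "(\<lambda>w. g (cube_fst w) (cube_snd w)) \<in> borel_measurable \<Omega>"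
  using assms cube_fst_measurable_Omega cube_snd_measurable_Omega
  by (auto simp: jointly_measurable_def cube_space_def)

text \<open>For \<open>P\<close> in \<open>cube_probs\<close> this is the restriction of
  \<open>P\<close> to the Borel sets; pushing forward along the identity to a coarser sigma-algebra
  restricts a measure.\<close>

definition borel_part :: "cube measure \<Rightarrow> cube measure" where
  "borel_part P = distr P cube_borel (\<lambda>x. x)"

lemma measurable_id_cube_probs_cube_borel:
  "P \<in> cube_probs \<Longrightarrow> (\<lambda>x. x) \<in> P \<rightarrow>\<^sub>M cube_borel"
  using measurable_id_Omega_cube_borel measurable_cong_sets[OF cube_probsD(2) refl] by blast

lemma borel_part_probs: "P \<in> cube_probs \<Longrightarrow> borel_part P \<in> cube_borel_probs"
  using prob_space.prob_space_distr[OF cube_probsD(1) measurable_id_cube_probs_cube_borel]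
  by (simp add: borel_part_def cube_borel_probs_def)

text \<open>Null sets of the restriction are null for \<open>P\<close>, so \<open>h\<close> may be
  replaced by its Borel version under \<open>P\<close>; the integral of a Borel function sees only
  the Borel part.\<close>

lemma nn_integral_borel_part:
  assumes P: "P \<in> cube_probs" and h': "h' \<in> borel_measurable cube_borel"
    and eq: "AE x in borel_part P. h x = h' x"
  shows "(\<integral>\<^sup>+ x. h x \<partial>P) = (\<integral>\<^sup>+ x. h' x \<partial>borel_part P)"
proof -
  have "AE x in P. h x = h' x"
    using AE_distrD[OF measurable_id_cube_probs_cube_borel[OF P]] eq
    unfolding borel_part_def by blast
  then have "(\<integral>\<^sup>+ x. h x \<partial>P) = (\<integral>\<^sup>+ x. h' x \<partial>P)" by (rule nn_integral_cong_AE)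
  also have "\<dots> = (\<integral>\<^sup>+ x. h' x \<partial>borel_part P)"
    unfolding borel_part_def
    using h' by (subst nn_integral_distr[OF measurable_id_cube_probs_cube_borel[OF P]]) simp_all
  finally show ?thesis .
qed

definition cube_prod_borel :: "cube measure \<Rightarrow> cube measure \<Rightarrow> cube measure" where
  "cube_prod_borel R R' = distr (R \<Otimes>\<^sub>M R') cube_borel (\<lambda>w. cube_pair (fst w) (snd w))"

lemma measurable_cube_pair_prod:
  assumes "R \<in> cube_borel_probs" "R' \<in> cube_borel_probs"
  shows "(\<lambda>w. cube_pair (fst w) (snd w)) \<in> R \<Otimes>\<^sub>M R' \<rightarrow>\<^sub>M cube_borel"
  using measurable_cube_pair assms[THEN cube_borel_probsD(2)]
  by (simp cong: measurable_cong_sets sets_pair_measure_cong)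

lemma cube_prod_borel_probs:
  assumes "R \<in> cube_borel_probs" "R' \<in> cube_borel_probs"
  shows "cube_prod_borel R R' \<in> cube_borel_probs"
proof -
  interpret R: prob_space R using assms by (simp add: cube_borel_probsD)
  interpret R': prob_space R' using assms by (simp add: cube_borel_probsD)
  interpret pair_prob_space R R' ..
  show ?thesis
    using prob_space_distr[OF measurable_cube_pair_prod[OF assms]]
    by (simp add: cube_prod_borel_def cube_borel_probs_def)
qed

text \<open>The product of the Borel parts, carried over to the cube, extends to \<open>\<Omega>\<close> because its completion
  contains all universally measurable sets.\<close>

definition cube_prod :: "cube measure \<Rightarrow> cube measure \<Rightarrow> cube measure" where
  "cube_prod P P' =
     distr (completion (cube_prod_borel (borel_part P) (borel_part P'))) \<Omega> (\<lambda>x. x)"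

lemma cube_prod_probs:
  assumes "P \<in> cube_probs" "P' \<in> cube_probs"
  shows "cube_prod P P' \<in> cube_probs"
proof -
  let ?R = "cube_prod_borel (borel_part P) (borel_part P')"
  have R: "?R \<in> cube_borel_probs"
    using assms by (intro cube_prod_borel_probs borel_part_probs)
  interpret prob_space ?R using R by (rule cube_borel_probsD)
  have "prob_space (completion ?R)"
    by (rule prob_spaceI) (simp add: emeasure_space_1)
  then show ?thesis
    using prob_space.prob_space_distr[OF _ measurable_id_completion_Omega[OF R]]
    by (simp add: cube_prod_def cube_probs_def)
qed

text \<open>One Borel version, taken for the interleaved product measure, serves all three
  statements. Pulled back along the interleaving it is an almost sure equality for the product of
  \<open>R\<close> and \<open>R'\<close>, which passes to almost all sections in either
  order.\<close>

lemma jointly_measurable_ex_borel: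
  assumes g: "jointly_measurable cube_space cube_space g"
    and R: "R \<in> cube_borel_probs" "R' \<in> cube_borel_probs"
  shows "\<exists>h'\<in>borel_measurable cube_borel.
    (AE x in cube_prod_borel R R'. g (cube_fst x) (cube_snd x) = h' x) \<and>
    (AE x in R. AE y in R'. g x y = h' (cube_pair x y)) \<and>
    (AE y in R'. AE x in R. g x y = h' (cube_pair x y))"
proof -
  interpret R: prob_space R using R by (simp add: cube_borel_probsD)
  interpret R': prob_space R' using R by (simp add: cube_borel_probsD)
  interpret RR: pair_prob_space R R' ..
  interpret RR': pair_prob_space R' R ..
  from Omega_measurable_ex_borel[OF jointly_measurable_cube_fst_snd[OF g] cube_prod_borel_probs[OF R]]
  obtain h'
    where h': "h' \<in> borel_measurable cube_borel"
      and eq: "AE x in cube_prod_borel R R'. g (cube_fst x) (cube_snd x) = h' x" by blast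
  have eq2: "AE w in R \<Otimes>\<^sub>M R'. g (fst w) (snd w) = h' (cube_pair (fst w) (snd w))"
    using AE_distrD[OF measurable_cube_pair_prod[OF R] eq[unfolded cube_prod_borel_def]] by simp
  \<comment> \<open>The product measure is rewritten as the flip of the product in the opposite
    order, because \<open>AE_pair\<close> only slices with the first factor outermost.\<close>
  have "AE w in distr (R' \<Otimes>\<^sub>M R) (R \<Otimes>\<^sub>M R') (\<lambda>(x, y). (y, x)).
      g (fst w) (snd w) = h' (cube_pair (fst w) (snd w))"
    using eq2 unfolding RR.distr_pair_swap[symmetric] .
  from AE_distrD[OF measurable_pair_swap' this]
  have "AE w in R' \<Otimes>\<^sub>M R. g (snd w) (fst w) = h' (cube_pair (snd w) (fst w))"
    by (simp add: case_prod_beta)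
  from RR'.AE_pair[OF this] RR.AE_pair[OF eq2] show ?thesis
    using h' eq by auto
qed

text \<open>Classical Tonelli makes the inner integral of the Borel version Borel. Here
  \<open>h'\<close> lives on the product and not on the interleaved cube, so that both orders of
  integration can use the lemma.\<close>

lemma inner_nn_integral_AE_borel:
  assumes P: "P \<in> cube_probs" and R': "R' \<in> cube_borel_probs"
    and h'[measurable]: "h' \<in> borel_measurable (cube_borel \<Otimes>\<^sub>M cube_borel)"
    and eq: "AE y in R'. AE x in borel_part P. g x y = h' (x, y)"
  shows "(\<lambda>y. \<integral>\<^sup>+ x. h' (x, y) \<partial>borel_part P) \<in> borel_measurable cube_borel"
    and "AE y in R'. (\<integral>\<^sup>+ x. g x y \<partial>P) = (\<integral>\<^sup>+ x. h' (x, y) \<partial>borel_part P)"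
proof -
  note R = borel_part_probs[OF P]
  interpret R: prob_space "borel_part P" using R by (simp add: cube_borel_probsD)
  note [measurable_cong] = cube_borel_probsD(2)[OF R]
  show "(\<lambda>y. \<integral>\<^sup>+ x. h' (x, y) \<partial>borel_part P) \<in> borel_measurable cube_borel"
    by measurable
  have "(\<lambda>x. h' (x, y)) \<in> borel_measurable cube_borel" for y
    by measurable
  from nn_integral_borel_part[OF P this] show
    "AE y in R'. (\<integral>\<^sup>+ x. g x y \<partial>P) = (\<integral>\<^sup>+ x. h' (x, y) \<partial>borel_part P)"
    using eq by fastforce
qed

text \<open>For each test measure \<open>R'\<close> the inner integral has a Borel version, namely
  the inner integral of a Borel version of \<open>g\<close> chosen for \<open>R'\<close>;
  \<open>Omega_measurable_if_AE_borel\<close> permits this dependence on \<open>R'\<close>.\<close>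

lemma measurable_nn_integral_cube:
  assumes P: "P \<in> cube_probs" and g: "jointly_measurable cube_space cube_space g"
  shows "(\<lambda>y. \<integral>\<^sup>+ x. g x y \<partial>P) \<in> borel_measurable \<Omega>"
proof (rule Omega_measurable_if_AE_borel)
  fix R' assume R': "R' \<in> cube_borel_probs"
  obtain h' where [measurable]: "h' \<in> borel_measurable cube_borel"
    and eq: "AE y in R'. AE x in borel_part P. g x y = h' (cube_pair x y)"
    using jointly_measurable_ex_borel[OF g borel_part_probs[OF P] R'] by blast
  have "(\<lambda>w. h' (cube_pair (fst w) (snd w))) \<in> borel_measurable (cube_borel \<Otimes>\<^sub>M cube_borel)"
    by measurable
  from inner_nn_integral_AE_borel[OF P R' this, of g] eq
  show "\<exists>h'\<in>borel_measurable cube_borel. AE y in R'. (\<integral>\<^sup>+ x. g x y \<partial>P) = h' y"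
    by (intro bexI[of _ "\<lambda>y. \<integral>\<^sup>+ x. h' (cube_pair x y) \<partial>borel_part P"]) simp_all
qed

text \<open>All three integrals equal the integral of one Borel function \<open>k\<close> against
  the product of the Borel parts, where classical Tonelli applies.\<close>

lemma nn_integral_cube_prod:
  assumes P: "P \<in> cube_probs" and P': "P' \<in> cube_probs"
    and g: "jointly_measurable cube_space cube_space g"
  shows "(\<integral>\<^sup>+ w. g (cube_fst w) (cube_snd w) \<partial>cube_prod P P') = (\<integral>\<^sup>+ y. \<integral>\<^sup>+ x. g x y \<partial>P \<partial>P')"
    and "(\<integral>\<^sup>+ y. \<integral>\<^sup>+ x. g x y \<partial>P \<partial>P') = (\<integral>\<^sup>+ x. \<integral>\<^sup>+ y. g x y \<partial>P' \<partial>P)"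
proof -
  let ?R = "borel_part P" and ?R' = "borel_part P'"
  note R = borel_part_probs[OF P] and R' = borel_part_probs[OF P']
  interpret R: prob_space ?R using R by (simp add: cube_borel_probsD)
  interpret R': prob_space ?R' using R' by (simp add: cube_borel_probsD)
  interpret RR: pair_prob_space ?R ?R' ..
  note [measurable_cong] = cube_borel_probsD(2)[OF R] cube_borel_probsD(2)[OF R']
  obtain h' where h'[measurable]: "h' \<in> borel_measurable cube_borel"
    and eq: "AE x in cube_prod_borel ?R ?R'. g (cube_fst x) (cube_snd x) = h' x"
    and eq1: "AE x in ?R. AE y in ?R'. g x y = h' (cube_pair x y)"
    and eq2: "AE y in ?R'. AE x in ?R. g x y = h' (cube_pair x y)"
    using jointly_measurable_ex_borel[OF g R R'] by blast
  define k where "k w = h' (cube_pair (fst w) (snd w))" for w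
  have k[measurable]: "k \<in> borel_measurable (cube_borel \<Otimes>\<^sub>M cube_borel)"
    unfolding k_def by measurable
  \<comment> \<open>With its arguments exchanged, \<open>k\<close> fits the inner-integral lemma for
    the factors in the opposite order.\<close>
  have k': "(\<lambda>w. k (snd w, fst w)) \<in> borel_measurable (cube_borel \<Otimes>\<^sub>M cube_borel)"
    by measurable
  have "AE y in ?R'. AE x in ?R. g x y = k (x, y)"
    using eq2 by (simp add: k_def)
  note inner = inner_nn_integral_AE_borel[OF P R' k this]
  have yx: "(\<integral>\<^sup>+ y. \<integral>\<^sup>+ x. g x y \<partial>P \<partial>P') = (\<integral>\<^sup>+ w. k w \<partial>(?R \<Otimes>\<^sub>M ?R'))"
    using nn_integral_borel_part[OF P' inner] RR.nn_integral_snd[of k]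
    by (simp add: case_prod_beta)
  have "AE x in ?R. AE y in ?R'. g x y = k (snd (y, x), fst (y, x))"
    using eq1 by (simp add: k_def)
  note inner' = inner_nn_integral_AE_borel[OF P' R k' this]
  have xy: "(\<integral>\<^sup>+ x. \<integral>\<^sup>+ y. g x y \<partial>P' \<partial>P) = (\<integral>\<^sup>+ w. k w \<partial>(?R \<Otimes>\<^sub>M ?R'))"
    using nn_integral_borel_part[OF P inner'] R'.nn_integral_fst[of k ?R]
    by simp
  show "(\<integral>\<^sup>+ y. \<integral>\<^sup>+ x. g x y \<partial>P \<partial>P') = (\<integral>\<^sup>+ x. \<integral>\<^sup>+ y. g x y \<partial>P' \<partial>P)"
    using xy yx by simp
  \<comment> \<open>Neither the extension to \<Omega> nor the completion changes this integral; only
    afterwards is \<open>g\<close> replaced by its Borel version.\<close>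
  have "(\<integral>\<^sup>+ w. g (cube_fst w) (cube_snd w) \<partial>cube_prod P P')
      = (\<integral>\<^sup>+ w. g (cube_fst w) (cube_snd w) \<partial>cube_prod_borel ?R ?R')"
    unfolding cube_prod_def using jointly_measurable_cube_fst_snd[OF g]
    by (simp add: nn_integral_distr nn_integral_completion
        measurable_id_completion_Omega[OF cube_prod_borel_probs[OF R R']])
  also have "\<dots> = (\<integral>\<^sup>+ w. h' w \<partial>cube_prod_borel ?R ?R')"
    using eq by (rule nn_integral_cong_AE)
  also have "\<dots> = (\<integral>\<^sup>+ w. k w \<partial>(?R \<Otimes>\<^sub>M ?R'))"
    unfolding cube_prod_borel_def k_def
    by (simp add: nn_integral_distr measurable_cube_pair_prod[OF R R'])
  finally show "(\<integral>\<^sup>+ w. g (cube_fst w) (cube_snd w) \<partial>cube_prod P P')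
      = (\<integral>\<^sup>+ y. \<integral>\<^sup>+ x. g x y \<partial>P \<partial>P')"
    using yx by simp
qed


section \<open>Function spaces\<close>

lemma measurable_const_Omega: "(\<lambda>_. \<omega>) \<in> \<Omega> \<rightarrow>\<^sub>M \<Omega>"
  by simp

lemma rvs_in_pts: "quasi_universal X \<Longrightarrow> f \<in> rvs X \<Longrightarrow> f \<omega> \<in> pts X"
  by (auto simp: quasi_universal_def)

lemma const_in_rvs: "quasi_universal X \<Longrightarrow> x \<in> pts X \<Longrightarrow> (\<lambda>_. x) \<in> rvs X"
  by (auto simp: quasi_universal_def)

lemma rvs_compose:
  "quasi_universal X \<Longrightarrow> f \<in> rvs X \<Longrightarrow> \<phi> \<in> \<Omega> \<rightarrow>\<^sub>M \<Omega> \<Longrightarrow> (\<lambda>\<omega>. f (\<phi> \<omega>)) \<in> rvs X"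
  by (auto simp: quasi_universal_def comp_def)

lemma quasi_universal_cube_space: "quasi_universal cube_space"
  by (auto simp: quasi_universal_def cube_space_def)

lemma quasi_universal_ennreal_space: "quasi_universal ennreal_space"
  by (auto simp: quasi_universal_def ennreal_space_def)

lemma pts_qprod [simp]: "pts (X \<times>\<^sub>Q Y) = pts X \<times> pts Y"
  by (simp add: qprod_def)

lemma rvs_qprod_iff:
  "f \<in> rvs (X \<times>\<^sub>Q Y) \<longleftrightarrow> (\<lambda>\<omega>. fst (f \<omega>)) \<in> rvs X \<and> (\<lambda>\<omega>. snd (f \<omega>)) \<in> rvs Y"
  by (simp add: qprod_def comp_def)

lemma quasi_universal_qprod:
  assumes "quasi_universal X" "quasi_universal Y"
  shows "quasi_universal (X \<times>\<^sub>Q Y)"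
proof -
  have "range f \<subseteq> pts (X \<times>\<^sub>Q Y)" if "f \<in> rvs (X \<times>\<^sub>Q Y)" for f
    using that assms[THEN rvs_in_pts] by (fastforce simp: rvs_qprod_iff mem_Times_iff)
  moreover have "(\<lambda>_. w) \<in> rvs (X \<times>\<^sub>Q Y)" if "w \<in> pts (X \<times>\<^sub>Q Y)" for w
    using that assms[THEN const_in_rvs] by (auto simp: rvs_qprod_iff)
  moreover have "f \<circ> \<phi> \<in> rvs (X \<times>\<^sub>Q Y)" if "f \<in> rvs (X \<times>\<^sub>Q Y)" "\<phi> \<in> \<Omega> \<rightarrow>\<^sub>M \<Omega>" for f \<phi>
    using that assms[THEN rvs_compose] by (auto simp: rvs_qprod_iff)
  ultimately show ?thesis
    unfolding quasi_universal_def by blast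
qed

lemma qmeas_PiE: "g \<in> X \<rightarrow>\<^sub>Q Y \<Longrightarrow> g \<in> pts X \<rightarrow>\<^sub>E pts Y"
  by (simp add: qmeas_def)

text \<open>That values land in \<open>pts Y\<close> is automatic: a point of \<open>X\<close> is a
  constant random variable, and the image of that variable has its values in
  \<open>pts Y\<close>.\<close>

lemma qmeas_iff:
  assumes "quasi_universal X" "quasi_universal Y"
  shows "g \<in> X \<rightarrow>\<^sub>Q Y \<longleftrightarrow> g \<in> extensional (pts X) \<and> (\<forall>x\<in>rvs X. (\<lambda>\<omega>. g (x \<omega>)) \<in> rvs Y)"
proof -
  have "g x \<in> pts Y" if "\<forall>x\<in>rvs X. (\<lambda>\<omega>. g (x \<omega>)) \<in> rvs Y" "x \<in> pts X" for x
    by (rule rvs_in_pts[OF assms(2) bspec[OF that(1) const_in_rvs[OF assms(1) that(2)]]])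
  then show ?thesis
    by (auto simp: qmeas_def PiE_iff comp_def)
qed

text \<open>An admissible random variable of the product of the cube with \<open>X\<close> is a pair
  of a reparametrisation \<phi> and a random variable \<open>x\<close> of \<open>X\<close>, so the
  uncurried condition can be stated without a restricted function on the product.\<close>

lemma rvs_qexp_iff:
  assumes X: "quasi_universal X" and Y: "quasi_universal Y"
  shows "F \<in> rvs (X \<Rightarrow>\<^sub>Q Y) \<longleftrightarrow>
    (\<forall>\<omega>. F \<omega> \<in> extensional (pts X)) \<and>
    (\<forall>\<phi>\<in>\<Omega> \<rightarrow>\<^sub>M \<Omega>. \<forall>x\<in>rvs X. (\<lambda>\<omega>. F (\<phi> \<omega>) (x \<omega>)) \<in> rvs Y)"
    (is "_ \<longleftrightarrow> ?E \<and> ?M")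
proof -
  note CX = quasi_universal_qprod[OF quasi_universal_cube_space X]
  let ?G = "\<lambda>(\<omega>, x) \<in> UNIV \<times> pts X. F \<omega> x"
  have "?G \<in> cube_space \<times>\<^sub>Q X \<rightarrow>\<^sub>Q Y \<longleftrightarrow> ?M"
  proof
    assume G: "?G \<in> cube_space \<times>\<^sub>Q X \<rightarrow>\<^sub>Q Y"
    show ?M
    proof (intro ballI)
      fix \<phi> x assume "\<phi> \<in> \<Omega> \<rightarrow>\<^sub>M \<Omega>" "x \<in> rvs X"
      then have "(\<lambda>\<omega>. (\<phi> \<omega>, x \<omega>)) \<in> rvs (cube_space \<times>\<^sub>Q X)"
        by (simp add: rvs_qprod_iff cube_space_def)
      from bspec[OF conjunct2[OF G[unfolded qmeas_iff[OF CX Y]]] this]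
      have "(\<lambda>\<omega>. ?G (\<phi> \<omega>, x \<omega>)) \<in> rvs Y" .
      then show "(\<lambda>\<omega>. F (\<phi> \<omega>) (x \<omega>)) \<in> rvs Y"
        by (simp add: rvs_in_pts[OF X \<open>x \<in> rvs X\<close>])
    qed
  next
    assume M: ?M
    have "(\<lambda>\<omega>. ?G (f \<omega>)) \<in> rvs Y" if "f \<in> rvs (cube_space \<times>\<^sub>Q X)" for f
    proof -
      have "(\<lambda>\<omega>. F (fst (f \<omega>)) (snd (f \<omega>))) \<in> rvs Y"
        using that M by (auto simp: rvs_qprod_iff cube_space_def)
      then show ?thesis
        using rvs_in_pts[OF CX that] by (simp add: case_prod_beta mem_Times_iff)
    qed
    then show "?G \<in> cube_space \<times>\<^sub>Q X \<rightarrow>\<^sub>Q Y"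
      unfolding qmeas_iff[OF CX Y] by (auto simp: cube_space_def)
  qed
  \<comment> \<open>Constant \<phi> already yields quasi-measurability of each
    \<open>F \<omega>\<close>, so only extensionality is left of the range condition.\<close>
  moreover have "range F \<subseteq> X \<rightarrow>\<^sub>Q Y \<longleftrightarrow> ?E" if ?M
    using that measurable_const_Omega by (auto simp: qmeas_iff[OF X Y] image_subset_iff)
  ultimately show ?thesis
    by (auto simp: qexp_def)
qed

lemma pts_qexp [simp]: "pts (X \<Rightarrow>\<^sub>Q Y) = X \<rightarrow>\<^sub>Q Y"
  by (simp add: qexp_def)

lemma quasi_universal_qexp:
  assumes X: "quasi_universal X" and Y: "quasi_universal Y"
  shows "quasi_universal (X \<Rightarrow>\<^sub>Q Y)"
proof -
  have "range F \<subseteq> X \<rightarrow>\<^sub>Q Y" if "F \<in> rvs (X \<Rightarrow>\<^sub>Q Y)" for F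
    using that by (simp add: qexp_def)
  moreover have "(\<lambda>_. g) \<in> rvs (X \<Rightarrow>\<^sub>Q Y)" if "g \<in> X \<rightarrow>\<^sub>Q Y" for g
    using that by (simp add: rvs_qexp_iff[OF X Y] qmeas_iff[OF X Y])
  moreover have "F \<circ> \<phi> \<in> rvs (X \<Rightarrow>\<^sub>Q Y)" if "F \<in> rvs (X \<Rightarrow>\<^sub>Q Y)" "\<phi> \<in> \<Omega> \<rightarrow>\<^sub>M \<Omega>" for F \<phi>
    using that measurable_compose[OF _ that(2)] by (simp add: rvs_qexp_iff[OF X Y])
  ultimately show ?thesis
    unfolding quasi_universal_def by simp
qed

text \<open>Evaluation is quasi-measurable: take \<phi> to be the identity in
  \<open>rvs_qexp_iff\<close>.\<close>

lemma rvs_qexp_apply: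
  assumes "quasi_universal X" "quasi_universal Y" "F \<in> rvs (X \<Rightarrow>\<^sub>Q Y)" "x \<in> rvs X"
  shows "(\<lambda>\<omega>. F \<omega> (x \<omega>)) \<in> rvs Y"
  by (rule bspec[OF bspec[OF conjunct2[OF iffD1[OF rvs_qexp_iff[OF assms(1,2)] assms(3)]]
          measurable_ident_sets[OF refl]] assms(4)])

text \<open>The currying half of cartesian closedness. The reparametrisation \<phi> is absorbed into
  \<open>a\<close>, because \<open>rvs A\<close> is closed under it.\<close>

lemma qmeas_into_qexpI:
  assumes A: "quasi_universal A" and X: "quasi_universal X" and Y: "quasi_universal Y"
    and ext: "g \<in> extensional (pts A)" "\<And>a. a \<in> pts A \<Longrightarrow> g a \<in> extensional (pts X)"
    and rv: "\<And>a x. a \<in> rvs A \<Longrightarrow> x \<in> rvs X \<Longrightarrow> (\<lambda>\<omega>. g (a \<omega>) (x \<omega>)) \<in> rvs Y"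
  shows "g \<in> A \<rightarrow>\<^sub>Q (X \<Rightarrow>\<^sub>Q Y)"
  unfolding qmeas_iff[OF A quasi_universal_qexp[OF X Y]] rvs_qexp_iff[OF X Y]
proof (intro conjI ballI allI)
  fix a assume a: "a \<in> rvs A"
  show "g (a \<omega>) \<in> extensional (pts X)" for \<omega>
    by (rule ext(2)[OF rvs_in_pts[OF A a]])
  show "(\<lambda>\<omega>. g (a (\<phi> \<omega>)) (x \<omega>)) \<in> rvs Y" if "\<phi> \<in> \<Omega> \<rightarrow>\<^sub>M \<Omega>" "x \<in> rvs X" for \<phi> x
    by (rule rv[OF rvs_compose[OF A a that(1)] that(2)])
qed (rule ext(1))

section \<open>Integration against push-forward measures\<close>

text \<open>The induced sigma-algebra is the final one for the admissible random variables, so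
  measurability can be tested along them.\<close>

lemma measurable_inducedI:
  assumes X: "quasi_universal X" and "F \<in> pts X \<rightarrow> space N"
    and F: "\<And>f. f \<in> rvs X \<Longrightarrow> (\<lambda>\<omega>. F (f \<omega>)) \<in> \<Omega> \<rightarrow>\<^sub>M N"
  shows "F \<in> induced X \<rightarrow>\<^sub>M N"
proof (rule measurableI)
  fix A assume A: "A \<in> sets N"
  have "f -` (F -` A \<inter> pts X) \<in> sets \<Omega>" if f: "f \<in> rvs X" for f
  proof -
    have "f -` (F -` A \<inter> pts X) = (\<lambda>\<omega>. F (f \<omega>)) -` A \<inter> space \<Omega>"
      using rvs_in_pts[OF X f] by auto
    then show ?thesis using measurable_sets[OF F[OF f] A] by simp
  qed
  then show "F -` A \<inter> space (induced X) \<in> sets (induced X)"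
    by (simp add: sets_induced[OF X])
qed (use assms in auto)

lemma rvs_measurable:
  assumes "quasi_universal X" "f \<in> rvs X" "P \<in> cube_probs"
  shows "f \<in> P \<rightarrow>\<^sub>M induced X"
proof -
  have "f \<in> \<Omega> \<rightarrow>\<^sub>M induced X"
    by (rule measurableI) (use assms in \<open>simp_all add: rvs_in_pts[OF assms(1,2)] sets_induced\<close>)
  then show ?thesis using cube_probsD(2)[OF assms(3)] by (simp cong: measurable_cong_sets)
qed

lemma qmeas_measurable:
  assumes X: "quasi_universal X" and Y: "quasi_universal Y" and g: "g \<in> X \<rightarrow>\<^sub>Q Y"
  shows "g \<in> induced X \<rightarrow>\<^sub>M induced Y"
proof (rule measurable_inducedI[OF X])
  show "g \<in> pts X \<rightarrow> space (induced Y)"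
    using g by (auto simp: qmeas_def)
  fix f assume "f \<in> rvs X"
  then have "(\<lambda>\<omega>. g (f \<omega>)) \<in> rvs Y" using g by (simp add: qmeas_iff[OF X Y])
  then show "(\<lambda>\<omega>. g (f \<omega>)) \<in> \<Omega> \<rightarrow>\<^sub>M induced Y"
    using rvs_in_pts[OF Y, of "\<lambda>\<omega>. g (f \<omega>)"]
    by (intro measurableI) (simp_all add: sets_induced[OF Y])
qed

lemma jointly_measurable_fst:
  assumes X: "quasi_universal X" and Y: "quasi_universal Y"
    and F: "jointly_measurable X Y F" and y: "y \<in> pts Y"
  shows "(\<lambda>x. F x y) \<in> borel_measurable (induced X)"
  using F const_in_rvs[OF Y y] by (intro measurable_inducedI[OF X]) (auto simp: jointly_measurable_def)

lemma jointly_measurable_compose: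
  assumes X: "quasi_universal X" and Y: "quasi_universal Y"
    and "jointly_measurable X Y F" "a \<in> rvs X" "b \<in> rvs Y"
  shows "jointly_measurable cube_space cube_space (\<lambda>\<omega> \<omega>'. F (a \<omega>) (b \<omega>'))"
  using assms(3) rvs_compose[OF X assms(4)] rvs_compose[OF Y assms(5)]
  by (auto simp: jointly_measurable_def cube_space_def)

lemma nn_integral_inner_distr:
  assumes X: "quasi_universal X" and Y: "quasi_universal Y"
    and F: "jointly_measurable X Y F" and P: "P \<in> cube_probs" and a: "a \<in> rvs X"
  shows "y \<in> pts Y \<Longrightarrow> (\<integral>\<^sup>+ x. F x y \<partial>distr P (induced X) a) = (\<integral>\<^sup>+ \<omega>. F (a \<omega>) y \<partial>P)"
    and "(\<lambda>y. \<integral>\<^sup>+ x. F x y \<partial>distr P (induced X) a) \<in> borel_measurable (induced Y)"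
proof -
  show eq: "(\<integral>\<^sup>+ x. F x y \<partial>distr P (induced X) a) = (\<integral>\<^sup>+ \<omega>. F (a \<omega>) y \<partial>P)"
    if "y \<in> pts Y" for y
    using jointly_measurable_fst[OF X Y F that] by (simp add: nn_integral_distr rvs_measurable X P a)
  show "(\<lambda>y. \<integral>\<^sup>+ x. F x y \<partial>distr P (induced X) a) \<in> borel_measurable (induced Y)"
  proof (rule measurable_inducedI[OF Y])
    fix b assume b: "b \<in> rvs Y"
    have "(\<lambda>\<omega>'. \<integral>\<^sup>+ \<omega>. F (a \<omega>) (b \<omega>') \<partial>P) \<in> borel_measurable \<Omega>"
      by (intro measurable_nn_integral_cube P jointly_measurable_compose[OF X Y F a b])
    then show "(\<lambda>\<omega>'. \<integral>\<^sup>+ x. F x (b \<omega>') \<partial>distr P (induced X) a) \<in> borel_measurable \<Omega>"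
      by (simp add: eq rvs_in_pts[OF Y b])
  qed simp
qed

lemma iterated_nn_integral_distr:
  assumes X: "quasi_universal X" and Y: "quasi_universal Y"
    and F: "jointly_measurable X Y F"
    and P: "P \<in> cube_probs" "P' \<in> cube_probs" and a: "a \<in> rvs X" and b: "b \<in> rvs Y"
  shows "(\<integral>\<^sup>+ y. \<integral>\<^sup>+ x. F x y \<partial>distr P (induced X) a \<partial>distr P' (induced Y) b)
       = (\<integral>\<^sup>+ \<omega>'. \<integral>\<^sup>+ \<omega>. F (a \<omega>) (b \<omega>') \<partial>P \<partial>P')"
  using nn_integral_inner_distr[OF X Y F P(1) a]
  by (simp add: nn_integral_distr rvs_measurable Y P b rvs_in_pts[OF Y b])

lemma pts_qprobE:
  assumes "\<mu> \<in> pts (qprob X)"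
  obtains P a where "P \<in> cube_probs" "a \<in> rvs X" "\<mu> = distr P (induced X) a"
  using assms by (auto simp: qprob_def)

text \<open>Once both measures are written as push-forwards, either side becomes an iterated
  integral over the cube; the second one uses the same reduction with the factors exchanged.\<close>

lemma qprob_Fubini:
  assumes X: "quasi_universal X" and Y: "quasi_universal Y"
    and F: "jointly_measurable X Y F"
    and \<mu>: "\<mu> \<in> pts (qprob X)" and \<nu>: "\<nu> \<in> pts (qprob Y)"
  shows "(\<integral>\<^sup>+ y. \<integral>\<^sup>+ x. F x y \<partial>\<mu> \<partial>\<nu>) = (\<integral>\<^sup>+ x. \<integral>\<^sup>+ y. F x y \<partial>\<nu> \<partial>\<mu>)"
proof -
  obtain P a where P: "P \<in> cube_probs" "a \<in> rvs X" "\<mu> = distr P (induced X) a"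
    using \<mu> by (rule pts_qprobE)
  obtain P' b where P': "P' \<in> cube_probs" "b \<in> rvs Y" "\<nu> = distr P' (induced Y) b"
    using \<nu> by (rule pts_qprobE)
  show ?thesis
    using nn_integral_cube_prod(2)[OF P(1) P'(1) jointly_measurable_compose[OF X Y F P(2) P'(2)]]
    by (simp add: P(3) P'(3) iterated_nn_integral_distr[OF X Y F P(1) P'(1) P(2) P'(2)]
      iterated_nn_integral_distr[OF Y X jointly_measurable_swap[OF F] P'(1) P(1) P'(2) P(2)])
qed


section \<open>The product of two probability measures\<close>

text \<open>The value of \<open>kernel_prod\<close> at one pair of parameters. That the set function
  really is a measure for points of \<open>qprob\<close> emerges from
  \<open>qprod_measure_distr\<close>.\<close>

definition qprod_measure ::
  "'a qspace \<Rightarrow> 'b qspace \<Rightarrow> 'a measure \<Rightarrow> 'b measure \<Rightarrow> ('a \<times> 'b) measure" where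
  "qprod_measure X Y \<mu> \<nu> =
     measure_of (pts (X \<times>\<^sub>Q Y)) (sets (induced (X \<times>\<^sub>Q Y)))
       (\<lambda>D. \<integral>\<^sup>+ y. emeasure \<mu> {x. (x, y) \<in> D} \<partial>\<nu>)"

lemma jointly_measurable_indicator:
  assumes X: "quasi_universal X" and Y: "quasi_universal Y"
    and D: "D \<in> sets (induced (X \<times>\<^sub>Q Y))"
  shows "jointly_measurable X Y (\<lambda>x y. indicator D (x, y))"
  unfolding jointly_measurable_def
proof (intro ballI)
  fix a b assume "a \<in> rvs X" "b \<in> rvs Y"
  then have "(\<lambda>\<omega>. (a \<omega>, b \<omega>)) \<in> rvs (X \<times>\<^sub>Q Y)" by (simp add: rvs_qprod_iff)
  then have "(\<lambda>\<omega>. (a \<omega>, b \<omega>)) -` D \<in> sets \<Omega>"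
    using D sets_induced[OF quasi_universal_qprod[OF X Y]] by simp
  then have "(\<lambda>\<omega>. indicator ((\<lambda>\<omega>. (a \<omega>, b \<omega>)) -` D) \<omega> :: ennreal) \<in> borel_measurable \<Omega>"
    by simp
  then show "(\<lambda>\<omega>. indicator D (a \<omega>, b \<omega>) :: ennreal) \<in> borel_measurable \<Omega>"
    by (simp add: indicator_def)
qed

lemma emeasure_section:
  assumes X: "quasi_universal X" and Y: "quasi_universal Y"
    and D: "D \<in> sets (induced (X \<times>\<^sub>Q Y))" and \<mu>: "sets \<mu> = sets (induced X)" and y: "y \<in> pts Y"
  shows "emeasure \<mu> {x. (x, y) \<in> D} = (\<integral>\<^sup>+ x. indicator D (x, y) \<partial>\<mu>)"
proof -
  have "(\<lambda>x. indicator D (x, y) :: ennreal) \<in> borel_measurable (induced X)"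
    using jointly_measurable_fst[OF X Y jointly_measurable_indicator[OF X Y D] y] .
  \<comment> \<open>Sections of \<open>D\<close> are measurable because their indicator is a section
    of a jointly measurable function; \<open>D\<close> itself need not be built from
    rectangles.\<close>
  then have "(\<lambda>x. indicator D (x, y) :: ennreal) -` {1} \<inter> space (induced X) \<in> sets (induced X)"
    by (rule measurable_sets) simp
  moreover have "(\<lambda>x. indicator D (x, y) :: ennreal) -` {1} \<inter> space (induced X) = {x. (x, y) \<in> D}"
    using sets.sets_into_space[OF D] by (auto simp: indicator_def split: if_splits)
  ultimately have "{x. (x, y) \<in> D} \<in> sets \<mu>" using \<mu> by simp
  then have "emeasure \<mu> {x. (x, y) \<in> D} = (\<integral>\<^sup>+ x. indicator {x. (x, y) \<in> D} x \<partial>\<mu>)"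
    by simp
  then show ?thesis by (simp add: indicator_def)
qed

lemma rvs_cube_pair:
  assumes X: "quasi_universal X" and Y: "quasi_universal Y" and "a \<in> rvs X" "b \<in> rvs Y"
  shows "(\<lambda>w. (a (cube_fst w), b (cube_snd w))) \<in> rvs (X \<times>\<^sub>Q Y)"
  using rvs_compose[OF X assms(3) cube_fst_measurable_Omega]
    rvs_compose[OF Y assms(4) cube_snd_measurable_Omega]
  by (simp add: rvs_qprod_iff)

lemma emeasure_distr_cube_prod:
  assumes X: "quasi_universal X" and Y: "quasi_universal Y"
    and P: "P \<in> cube_probs" "P' \<in> cube_probs" and a: "a \<in> rvs X" and b: "b \<in> rvs Y"
    and D: "D \<in> sets (induced (X \<times>\<^sub>Q Y))"
  shows "emeasure (distr (cube_prod P P') (induced (X \<times>\<^sub>Q Y)) (\<lambda>w. (a (cube_fst w), b (cube_snd w)))) D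
    = (\<integral>\<^sup>+ y. \<integral>\<^sup>+ x. indicator D (x, y) \<partial>distr P (induced X) a \<partial>distr P' (induced Y) b)"
    (is "emeasure ?M D = _")
proof -
  note F = jointly_measurable_indicator[OF X Y D]
  note meas = rvs_measurable[OF quasi_universal_qprod[OF X Y] rvs_cube_pair[OF X Y a b] cube_prod_probs[OF P]]
  have "emeasure ?M D = (\<integral>\<^sup>+ d. indicator D d \<partial>?M)"
    using D by (intro nn_integral_indicator[symmetric]) simp
  also have "\<dots> = (\<integral>\<^sup>+ w. indicator D (a (cube_fst w), b (cube_snd w)) \<partial>cube_prod P P')"
    using D by (intro nn_integral_distr[OF meas]) simp
  also have "\<dots> = (\<integral>\<^sup>+ \<omega>'. \<integral>\<^sup>+ \<omega>. indicator D (a \<omega>, b \<omega>') \<partial>P \<partial>P')"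
    by (rule nn_integral_cube_prod(1)[OF P jointly_measurable_compose[OF X Y F a b]])
  also have "\<dots> = (\<integral>\<^sup>+ y. \<integral>\<^sup>+ x. indicator D (x, y) \<partial>distr P (induced X) a \<partial>distr P' (induced Y) b)"
    by (rule iterated_nn_integral_distr[OF X Y F P a b, symmetric])
  finally show ?thesis .
qed

text \<open>\<open>measure_of\<close> depends only on the values of the set function on the
  sigma-algebra. There it agrees with a push-forward of \<open>cube_prod P P'\<close>, which is a
  measure.\<close>

lemma qprod_measure_distr:
  assumes X: "quasi_universal X" and Y: "quasi_universal Y"
    and P: "P \<in> cube_probs" "P' \<in> cube_probs" and a: "a \<in> rvs X" and b: "b \<in> rvs Y"
  shows "qprod_measure X Y (distr P (induced X) a) (distr P' (induced Y) b)
    = distr (cube_prod P P') (induced (X \<times>\<^sub>Q Y)) (\<lambda>w. (a (cube_fst w), b (cube_snd w)))"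
    (is "_ = ?M")
proof -
  let ?\<mu> = "distr P (induced X) a" and ?\<nu> = "distr P' (induced Y) b"
  have "(\<integral>\<^sup>+ y. emeasure ?\<mu> {x. (x, y) \<in> D} \<partial>?\<nu>) = emeasure ?M D"
    if D: "D \<in> sets (induced (X \<times>\<^sub>Q Y))" for D
    unfolding emeasure_distr_cube_prod[OF assms D]
    by (rule nn_integral_cong) (simp add: emeasure_section[OF X Y D])
  then have "qprod_measure X Y ?\<mu> ?\<nu>
      = measure_of (space (induced (X \<times>\<^sub>Q Y))) (sets (induced (X \<times>\<^sub>Q Y))) (emeasure ?M)"
    unfolding qprod_measure_def space_induced[symmetric]
    by (intro measure_of_eq sets.space_closed) (simp only: sets.sigma_sets_eq)
  also have "\<dots> = ?M"
    using measure_of_of_measure[of ?M] by simp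
  finally show ?thesis .
qed

section \<open>Admissible random variables of the spaces of probability measures\<close>

lemma rvs_qprobE:
  assumes "M \<in> rvs (qprob X)"
  obtains P F where "P \<in> cube_probs" "F \<in> rvs (cube_space \<Rightarrow>\<^sub>Q X)"
    "M = (\<lambda>\<omega>. distr P (induced X) (F \<omega>))"
  using assms by (auto simp: qprob_def)

lemma rvs_qprobI:
  assumes "P \<in> cube_probs" "F \<in> rvs (cube_space \<Rightarrow>\<^sub>Q X)"
  shows "(\<lambda>\<omega>. distr P (induced X) (F \<omega>)) \<in> rvs (qprob X)"
  using assms by (auto simp: qprob_def)

lemma rvs_cube_qexp_iff:
  assumes "quasi_universal X"
  shows "F \<in> rvs (cube_space \<Rightarrow>\<^sub>Q X) \<longleftrightarrow>
    (\<forall>\<phi>\<in>\<Omega> \<rightarrow>\<^sub>M \<Omega>. \<forall>\<psi>\<in>\<Omega> \<rightarrow>\<^sub>M \<Omega>. (\<lambda>\<omega>. F (\<phi> \<omega>) (\<psi> \<omega>)) \<in> rvs X)"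
  unfolding rvs_qexp_iff[OF quasi_universal_cube_space assms] by (simp add: cube_space_def)

lemma rvs_cube_qexp_compose:
  assumes "quasi_universal X" "F \<in> rvs (cube_space \<Rightarrow>\<^sub>Q X)" "\<phi> \<in> \<Omega> \<rightarrow>\<^sub>M \<Omega>" "\<psi> \<in> \<Omega> \<rightarrow>\<^sub>M \<Omega>"
  shows "(\<lambda>\<omega> w. F (\<phi> \<omega>) (\<psi> w)) \<in> rvs (cube_space \<Rightarrow>\<^sub>Q X)"
  unfolding rvs_cube_qexp_iff[OF assms(1)]
proof (intro ballI)
  fix \<phi>' \<psi>' assume "\<phi>' \<in> \<Omega> \<rightarrow>\<^sub>M \<Omega>" "\<psi>' \<in> \<Omega> \<rightarrow>\<^sub>M \<Omega>"
  then have "(\<lambda>\<omega>. \<phi> (\<phi>' \<omega>)) \<in> \<Omega> \<rightarrow>\<^sub>M \<Omega>" "(\<lambda>\<omega>. \<psi> (\<psi>' \<omega>)) \<in> \<Omega> \<rightarrow>\<^sub>M \<Omega>"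
    using assms(3,4) by (auto intro: measurable_compose)
  from bspec[OF bspec[OF iffD1[OF rvs_cube_qexp_iff[OF assms(1)] assms(2)] this(1)] this(2)]
  show "(\<lambda>\<omega>. F (\<phi> (\<phi>' \<omega>)) (\<psi> (\<psi>' \<omega>))) \<in> rvs X" .
qed

lemma rvs_cube_qexp_rvs:
  assumes "quasi_universal X" "F \<in> rvs (cube_space \<Rightarrow>\<^sub>Q X)"
  shows "F \<omega> \<in> rvs X"
  using rvs_in_pts[OF quasi_universal_qexp[OF quasi_universal_cube_space assms(1)] assms(2)]
    pts_cube_space_qexp[OF assms(1)] by simp

lemma quasi_universal_qprob:
  assumes X: "quasi_universal X"
  shows "quasi_universal (qprob X)"
proof -
  have "range M \<subseteq> pts (qprob X)" if M: "M \<in> rvs (qprob X)" for M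
    using M rvs_cube_qexp_rvs[OF X] by (elim rvs_qprobE) (auto simp: qprob_def)
  moreover have "(\<lambda>_. \<mu>) \<in> rvs (qprob X)" if "\<mu> \<in> pts (qprob X)" for \<mu>
    \<comment> \<open>A constant measure is represented by a family of random variables that ignores
      its parameter.\<close>
    using that rvs_qprobI[of _ "\<lambda>_. _" X] rvs_compose[OF X]
    by (elim pts_qprobE) (simp add: rvs_cube_qexp_iff[OF X])
  moreover have "M \<circ> \<phi> \<in> rvs (qprob X)" if "M \<in> rvs (qprob X)" "\<phi> \<in> \<Omega> \<rightarrow>\<^sub>M \<Omega>" for M \<phi>
    using that(1)
  proof (rule rvs_qprobE)
    fix P F assume "P \<in> cube_probs" "F \<in> rvs (cube_space \<Rightarrow>\<^sub>Q X)"
      and M: "M = (\<lambda>\<omega>. distr P (induced X) (F \<omega>))"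
    then have "(\<lambda>\<omega>. distr P (induced X) (F (\<phi> \<omega>))) \<in> rvs (qprob X)"
      using rvs_cube_qexp_compose[OF X _ that(2) measurable_ident_sets[OF refl]]
      by (intro rvs_qprobI) auto
    then show ?thesis by (simp add: M comp_def)
  qed
  ultimately show ?thesis
    unfolding quasi_universal_def by blast
qed

lemma rvs_qprod_measure:
  assumes X: "quasi_universal X" and Y: "quasi_universal Y"
    and M: "M \<in> rvs (qprob X)" and N: "N \<in> rvs (qprob Y)"
  shows "(\<lambda>\<omega>. qprod_measure X Y (M \<omega>) (N \<omega>)) \<in> rvs (qprob (X \<times>\<^sub>Q Y))"
proof -
  obtain P F where P: "P \<in> cube_probs" and F: "F \<in> rvs (cube_space \<Rightarrow>\<^sub>Q X)"
    and M: "M = (\<lambda>\<omega>. distr P (induced X) (F \<omega>))"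
    using M by (rule rvs_qprobE)
  obtain P' G where P': "P' \<in> cube_probs" and G: "G \<in> rvs (cube_space \<Rightarrow>\<^sub>Q Y)"
    and N: "N = (\<lambda>\<omega>. distr P' (induced Y) (G \<omega>))"
    using N by (rule rvs_qprobE)
  \<comment> \<open>Admissibility in \<open>qprob\<close> demands a base measure independent of
    \<omega>. It is \<open>cube_prod P P'\<close>, and all dependence on \<omega> sits in
    \<open>?H\<close>.\<close>
  let ?H = "\<lambda>\<omega> w. (F \<omega> (cube_fst w), G \<omega> (cube_snd w))"
  have "?H \<in> rvs (cube_space \<Rightarrow>\<^sub>Q (X \<times>\<^sub>Q Y))"
    using
      rvs_cube_qexp_compose[OF X F measurable_ident_sets[OF refl]
        cube_fst_measurable_Omega]
      rvs_cube_qexp_compose[OF Y G measurable_ident_sets[OF refl]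
        cube_snd_measurable_Omega]
    by (simp add: rvs_cube_qexp_iff X Y quasi_universal_qprod rvs_qprod_iff)
  from rvs_qprobI[OF cube_prod_probs[OF P P'] this] show ?thesis
    by (simp add: M N qprod_measure_distr[OF X Y P P'] rvs_cube_qexp_rvs[OF X F]
        rvs_cube_qexp_rvs[OF Y G])
qed

lemma rvs_qprob_distr:
  assumes X: "quasi_universal X" and Y: "quasi_universal Y"
    and g: "g \<in> X \<rightarrow>\<^sub>Q Y" and M: "M \<in> rvs (qprob X)"
  shows "(\<lambda>\<omega>. distr (M \<omega>) (induced Y) g) \<in> rvs (qprob Y)"
proof -
  obtain P F where P: "P \<in> cube_probs" and F: "F \<in> rvs (cube_space \<Rightarrow>\<^sub>Q X)"
    and M: "M = (\<lambda>\<omega>. distr P (induced X) (F \<omega>))"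
    using M by (rule rvs_qprobE)
  have "(\<lambda>\<omega> w. g (F \<omega> w)) \<in> rvs (cube_space \<Rightarrow>\<^sub>Q Y)"
    using F g by (simp add: rvs_cube_qexp_iff X Y qmeas_iff)
  from rvs_qprobI[OF P this] show ?thesis
    by (simp add: M distr_distr[OF qmeas_measurable[OF X Y g]
        rvs_measurable[OF X rvs_cube_qexp_rvs[OF X F] P]] comp_def)
qed

lemma swap_map_qmeas:
  assumes "quasi_universal X" "quasi_universal Y"
  shows "swap_map X Y \<in> X \<times>\<^sub>Q Y \<rightarrow>\<^sub>Q Y \<times>\<^sub>Q X"
proof -
  have "(\<lambda>\<omega>. swap_map X Y (f \<omega>)) \<in> rvs (Y \<times>\<^sub>Q X)" if f: "f \<in> rvs (X \<times>\<^sub>Q Y)" for f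
  proof -
    have "f \<omega> \<in> pts X \<times> pts Y" for \<omega>
      using rvs_in_pts[OF quasi_universal_qprod[OF assms] f] by simp
    then show ?thesis
      using f by (simp add: rvs_qprod_iff swap_map_def case_prod_beta)
  qed
  then show ?thesis
    by (simp add: qmeas_iff quasi_universal_qprod assms) (simp add: swap_map_def)
qed

section \<open>Swapping the factors of a product measure\<close>

lemma emeasure_qprod_measure:
  assumes X: "quasi_universal X" and Y: "quasi_universal Y"
    and \<mu>: "\<mu> \<in> pts (qprob X)" and \<nu>: "\<nu> \<in> pts (qprob Y)"
    and D: "D \<in> sets (induced (X \<times>\<^sub>Q Y))"
  shows "emeasure (qprod_measure X Y \<mu> \<nu>) D = (\<integral>\<^sup>+ y. \<integral>\<^sup>+ x. indicator D (x, y) \<partial>\<mu> \<partial>\<nu>)"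
proof -
  obtain P a where P: "P \<in> cube_probs" "a \<in> rvs X" "\<mu> = distr P (induced X) a"
    using \<mu> by (rule pts_qprobE)
  obtain P' b where P': "P' \<in> cube_probs" "b \<in> rvs Y" "\<nu> = distr P' (induced Y) b"
    using \<nu> by (rule pts_qprobE)
  show ?thesis
    unfolding P(3) P'(3) qprod_measure_distr[OF X Y P(1) P'(1) P(2) P'(2)]
    by (rule emeasure_distr_cube_prod[OF X Y P(1) P'(1) P(2) P'(2) D])
qed

lemma sets_qprod_measure: "sets (qprod_measure X Y \<mu> \<nu>) = sets (induced (X \<times>\<^sub>Q Y))"
  unfolding qprod_measure_def space_induced[symmetric]
  by (simp add: sets_measure_of sets.space_closed sets.sigma_sets_eq del: space_induced)

lemma space_pts_qprob: "\<mu> \<in> pts (qprob X) \<Longrightarrow> space \<mu> = pts X"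
  by (auto simp: qprob_def)

text \<open>On a measurable set \<open>A\<close> this is the exchange of integrals for the indicator
  of \<open>A\<close> with its arguments swapped.\<close>

lemma distr_swap_qprod_measure:
  assumes X: "quasi_universal X" and Y: "quasi_universal Y"
    and \<mu>: "\<mu> \<in> pts (qprob X)" and \<nu>: "\<nu> \<in> pts (qprob Y)"
  shows "distr (qprod_measure X Y \<mu> \<nu>) (induced (Y \<times>\<^sub>Q X)) (swap_map X Y) = qprod_measure Y X \<nu> \<mu>"
    (is "?L = ?R")
proof (rule measure_eqI)
  show "sets ?L = sets ?R"
    by (simp add: sets_qprod_measure)
  fix A assume "A \<in> sets ?L"
  then have A: "A \<in> sets (induced (Y \<times>\<^sub>Q X))" by simp
  have space: "space (qprod_measure X Y \<mu> \<nu>) = pts (X \<times>\<^sub>Q Y)"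
    using sets_eq_imp_space_eq[OF sets_qprod_measure] by simp
  have meas: "swap_map X Y \<in> qprod_measure X Y \<mu> \<nu> \<rightarrow>\<^sub>M induced (Y \<times>\<^sub>Q X)"
    using qmeas_measurable[OF _ _ swap_map_qmeas[OF X Y]]
    by (simp add: X Y quasi_universal_qprod cong: measurable_cong_sets[OF sets_qprod_measure refl])
  let ?B = "swap_map X Y -` A \<inter> pts (X \<times>\<^sub>Q Y)"
  have B: "?B \<in> sets (induced (X \<times>\<^sub>Q Y))"
    using measurable_sets[OF meas A] by (simp only: space sets_qprod_measure)
  have "emeasure ?L A = emeasure (qprod_measure X Y \<mu> \<nu>) ?B"
    using emeasure_distr[OF meas A] by (simp only: space)
  also have "\<dots> = (\<integral>\<^sup>+ y. \<integral>\<^sup>+ x. indicator ?B (x, y) \<partial>\<mu> \<partial>\<nu>)"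
    by (rule emeasure_qprod_measure[OF X Y \<mu> \<nu> B])
  \<comment> \<open>The integrands agree on the points of the spaces, which suffices; elsewhere
    \<open>swap_map\<close> takes the value \<open>undefined\<close>.\<close>
  also have "\<dots> = (\<integral>\<^sup>+ y. \<integral>\<^sup>+ x. indicator A (y, x) \<partial>\<mu> \<partial>\<nu>)"
    by (intro nn_integral_cong)
      (simp add: space_pts_qprob[OF \<mu>] space_pts_qprob[OF \<nu>] indicator_def swap_map_def)
  also have "\<dots> = (\<integral>\<^sup>+ x. \<integral>\<^sup>+ y. indicator A (y, x) \<partial>\<nu> \<partial>\<mu>)"
    by (rule qprob_Fubini[OF X Y jointly_measurable_swap[OF jointly_measurable_indicator[OF Y X A]] \<mu> \<nu>])
  also have "\<dots> = emeasure ?R A"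
    by (rule emeasure_qprod_measure[OF Y X \<nu> \<mu> A, symmetric])
  finally show "emeasure ?L A = emeasure ?R A" .
qed


section \<open>Markov kernels\<close>

lemma kernel_prod_apply:
  assumes "K \<in> U \<rightarrow>\<^sub>Q qprob X" "Q \<in> Z \<rightarrow>\<^sub>Q qprob Y" "u \<in> pts U" "z \<in> pts Z"
  shows "kernel_prod X Y U Z (K, Q) (u, z) = qprod_measure X Y (K u) (Q z)"
  using assms by (simp add: kernel_prod_def qprod_measure_def)

text \<open>By currying it is enough to insert random kernels and random parameters. Evaluation
  turns these into random measures on \<open>X\<close> and \<open>Y\<close>, to which
  \<open>rvs_qprod_measure\<close> applies.\<close>

lemma kernel_prod_qmeas:
  assumes X: "quasi_universal X" and Y: "quasi_universal Y"
    and U: "quasi_universal U" and Z: "quasi_universal Z"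
  shows "kernel_prod X Y U Z
    \<in> (U \<Rightarrow>\<^sub>Q qprob X) \<times>\<^sub>Q (Z \<Rightarrow>\<^sub>Q qprob Y) \<rightarrow>\<^sub>Q (U \<times>\<^sub>Q Z \<Rightarrow>\<^sub>Q qprob (X \<times>\<^sub>Q Y))"
proof (rule qmeas_into_qexpI)
  note PX = quasi_universal_qprob[OF X] and PY = quasi_universal_qprob[OF Y]
  note UX = quasi_universal_qexp[OF U PX] and ZY = quasi_universal_qexp[OF Z PY]
  show A: "quasi_universal ((U \<Rightarrow>\<^sub>Q qprob X) \<times>\<^sub>Q (Z \<Rightarrow>\<^sub>Q qprob Y))"
    by (rule quasi_universal_qprod[OF UX ZY])
  show UZ: "quasi_universal (U \<times>\<^sub>Q Z)"
    by (rule quasi_universal_qprod[OF U Z])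
  show "quasi_universal (qprob (X \<times>\<^sub>Q Y))"
    by (intro quasi_universal_qprob quasi_universal_qprod X Y)
  show "kernel_prod X Y U Z \<in> extensional (pts ((U \<Rightarrow>\<^sub>Q qprob X) \<times>\<^sub>Q (Z \<Rightarrow>\<^sub>Q qprob Y)))"
    by (simp only: kernel_prod_def restrict_extensional)
  show "kernel_prod X Y U Z k \<in> extensional (pts (U \<times>\<^sub>Q Z))"
    if "k \<in> pts ((U \<Rightarrow>\<^sub>Q qprob X) \<times>\<^sub>Q (Z \<Rightarrow>\<^sub>Q qprob Y))" for k
    using that by (auto simp: kernel_prod_def)
  fix k w assume k: "k \<in> rvs ((U \<Rightarrow>\<^sub>Q qprob X) \<times>\<^sub>Q (Z \<Rightarrow>\<^sub>Q qprob Y))" and w: "w \<in> rvs (U \<times>\<^sub>Q Z)"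
  have "kernel_prod X Y U Z (k \<omega>) (w \<omega>)
      = qprod_measure X Y (fst (k \<omega>) (fst (w \<omega>))) (snd (k \<omega>) (snd (w \<omega>)))" for \<omega>
    using rvs_in_pts[OF A k, of \<omega>] rvs_in_pts[OF UZ w, of \<omega>]
      kernel_prod_apply[of "fst (k \<omega>)" U X "snd (k \<omega>)" Z Y "fst (w \<omega>)" "snd (w \<omega>)"]
    by (simp add: mem_Times_iff)
  moreover have "(\<lambda>\<omega>. qprod_measure X Y (fst (k \<omega>) (fst (w \<omega>))) (snd (k \<omega>) (snd (w \<omega>))))
      \<in> rvs (qprob (X \<times>\<^sub>Q Y))"
    using k w unfolding rvs_qprod_iff
    by (intro rvs_qprod_measure X Y rvs_qexp_apply[OF U PX] rvs_qexp_apply[OF Z PY]) auto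
  ultimately show "(\<lambda>\<omega>. kernel_prod X Y U Z (k \<omega>) (w \<omega>)) \<in> rvs (qprob (X \<times>\<^sub>Q Y))"
    by simp
qed

lemma push_kernel_qmeas:
  assumes W: "quasi_universal W" and X: "quasi_universal X" and Y: "quasi_universal Y"
    and g: "g \<in> X \<rightarrow>\<^sub>Q Y"
  shows "push_kernel W X Y g \<in> (W \<Rightarrow>\<^sub>Q qprob X) \<rightarrow>\<^sub>Q (W \<Rightarrow>\<^sub>Q qprob Y)"
proof (rule qmeas_into_qexpI)
  note PX = quasi_universal_qprob[OF X]
  show A: "quasi_universal (W \<Rightarrow>\<^sub>Q qprob X)"
    by (rule quasi_universal_qexp[OF W PX])
  show "quasi_universal (qprob Y)"
    by (rule quasi_universal_qprob[OF Y])
  fix L w assume L: "L \<in> rvs (W \<Rightarrow>\<^sub>Q qprob X)" and w: "w \<in> rvs W"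
  have "(\<lambda>\<omega>. distr (L \<omega> (w \<omega>)) (induced Y) g) \<in> rvs (qprob Y)"
    by (intro rvs_qprob_distr[OF X Y g] rvs_qexp_apply[OF W PX L w])
  then show "(\<lambda>\<omega>. push_kernel W X Y g (L \<omega>) (w \<omega>)) \<in> rvs (qprob Y)"
    using rvs_in_pts[OF A L] rvs_in_pts[OF W w] by (simp add: push_kernel_def)
qed (simp_all add: W push_kernel_def)

lemma precomp_qmeas:
  assumes W: "quasi_universal W" and V: "quasi_universal V" and T: "quasi_universal T"
    and h: "h \<in> W \<rightarrow>\<^sub>Q V"
  shows "precomp W V T h \<in> (V \<Rightarrow>\<^sub>Q T) \<rightarrow>\<^sub>Q (W \<Rightarrow>\<^sub>Q T)"
proof (rule qmeas_into_qexpI)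
  show A: "quasi_universal (V \<Rightarrow>\<^sub>Q T)"
    by (rule quasi_universal_qexp[OF V T])
  fix L w assume L: "L \<in> rvs (V \<Rightarrow>\<^sub>Q T)" and w: "w \<in> rvs W"
  have "(\<lambda>\<omega>. h (w \<omega>)) \<in> rvs V"
    using h w by (simp add: qmeas_iff[OF W V])
  from rvs_qexp_apply[OF V T L this]
  show "(\<lambda>\<omega>. precomp W V T h (L \<omega>) (w \<omega>)) \<in> rvs T"
    using rvs_in_pts[OF A L] rvs_in_pts[OF W w] by (simp add: precomp_def)
qed (simp_all add: W T precomp_def)

lemma kernel_prod_swap:
  assumes X: "quasi_universal X" and Y: "quasi_universal Y"
    and U: "quasi_universal U" and Z: "quasi_universal Z"
    and K: "K \<in> U \<rightarrow>\<^sub>Q qprob X" and Q: "Q \<in> Z \<rightarrow>\<^sub>Q qprob Y"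
  shows "push_kernel (U \<times>\<^sub>Q Z) (X \<times>\<^sub>Q Y) (Y \<times>\<^sub>Q X) (swap_map X Y) (kernel_prod X Y U Z (K, Q))
    = precomp (U \<times>\<^sub>Q Z) (Z \<times>\<^sub>Q U) (qprob (Y \<times>\<^sub>Q X)) (swap_map U Z) (kernel_prod Y X Z U (Q, K))"
    (is "?L = ?R")
proof
  fix w
  \<comment> \<open>\<open>push_kernel\<close> and \<open>precomp\<close> are restricted to kernels,
    so they unfold only after both products are known to be kernels.\<close>
  have KQ: "kernel_prod X Y U Z (K, Q) \<in> U \<times>\<^sub>Q Z \<rightarrow>\<^sub>Q qprob (X \<times>\<^sub>Q Y)"
    using PiE_mem[OF qmeas_PiE[OF kernel_prod_qmeas[OF X Y U Z]], of "(K, Q)"] K Q by simp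
  have QK: "kernel_prod Y X Z U (Q, K) \<in> Z \<times>\<^sub>Q U \<rightarrow>\<^sub>Q qprob (Y \<times>\<^sub>Q X)"
    using PiE_mem[OF qmeas_PiE[OF kernel_prod_qmeas[OF Y X Z U]], of "(Q, K)"] K Q by simp
  show "?L w = ?R w"
  proof (cases "w \<in> pts (U \<times>\<^sub>Q Z)")
    case True
    then obtain u z where w: "w = (u, z)" "u \<in> pts U" "z \<in> pts Z" by auto
    note swap = distr_swap_qprod_measure[OF X Y
        PiE_mem[OF qmeas_PiE[OF K] w(2)] PiE_mem[OF qmeas_PiE[OF Q] w(3)]]
    have "?L w = distr (qprod_measure X Y (K u) (Q z)) (induced (Y \<times>\<^sub>Q X)) (swap_map X Y)"
      using KQ w by (simp add: push_kernel_def kernel_prod_apply[OF K Q])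
    moreover have "?R w = qprod_measure Y X (Q z) (K u)"
      using QK w by (simp add: precomp_def swap_map_def kernel_prod_apply[OF Q K])
    ultimately show ?thesis using swap by simp
  next
    \<comment> \<open>Off the parameter space both sides are \<open>undefined\<close> by
      restriction.\<close>
    case False
    then show ?thesis using KQ QK by (simp add: push_kernel_def precomp_def)
  qed
qed

lemma qmeas_ennreal_jointly_measurable:
  assumes X: "quasi_universal X" and Y: "quasi_universal Y"
    and f: "f \<in> X \<times>\<^sub>Q Y \<rightarrow>\<^sub>Q ennreal_space"
  shows "jointly_measurable X Y (\<lambda>x y. f (x, y))"
  unfolding jointly_measurable_def
proof (intro ballI)
  fix a b assume "a \<in> rvs X" "b \<in> rvs Y"
  then have "(\<lambda>\<omega>. (a \<omega>, b \<omega>)) \<in> rvs (X \<times>\<^sub>Q Y)" by (simp add: rvs_qprod_iff)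
  moreover have "\<forall>w\<in>rvs (X \<times>\<^sub>Q Y). (\<lambda>\<omega>. f (w \<omega>)) \<in> borel_measurable \<Omega>"
    using f unfolding qmeas_iff[OF quasi_universal_qprod[OF X Y] quasi_universal_ennreal_space]
    by (simp add: ennreal_space_def)
  ultimately show "(\<lambda>\<omega>. f (a \<omega>, b \<omega>)) \<in> borel_measurable \<Omega>"
    by (rule bspec[rotated])
qed

text \<open>The memberships say that every arrow of the two composites is a quasi-measurable map
  between the stated spaces. \<open>compose\<close> is restricted to the common domain, so the HOL
  equation is equality of maps on that domain.\<close>

theorem theorem7p21:
  fixes X :: "'x qspace" and Y :: "'y qspace" and U :: "'u qspace" and Z :: "'z qspace"
  assumes "quasi_universal X" and "quasi_universal Y"
    and "quasi_universal U" and "quasi_universal Z"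
  shows
    "kernel_prod X Y U Z
       \<in> (U \<Rightarrow>\<^sub>Q qprob X) \<times>\<^sub>Q (Z \<Rightarrow>\<^sub>Q qprob Y) \<rightarrow>\<^sub>Q (U \<times>\<^sub>Q Z \<Rightarrow>\<^sub>Q qprob (X \<times>\<^sub>Q Y)) \<and>
     push_kernel (U \<times>\<^sub>Q Z) (X \<times>\<^sub>Q Y) (Y \<times>\<^sub>Q X) (swap_map X Y)
       \<in> (U \<times>\<^sub>Q Z \<Rightarrow>\<^sub>Q qprob (X \<times>\<^sub>Q Y)) \<rightarrow>\<^sub>Q (U \<times>\<^sub>Q Z \<Rightarrow>\<^sub>Q qprob (Y \<times>\<^sub>Q X)) \<and>
     swap_map (U \<Rightarrow>\<^sub>Q qprob X) (Z \<Rightarrow>\<^sub>Q qprob Y)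
       \<in> (U \<Rightarrow>\<^sub>Q qprob X) \<times>\<^sub>Q (Z \<Rightarrow>\<^sub>Q qprob Y) \<rightarrow>\<^sub>Q (Z \<Rightarrow>\<^sub>Q qprob Y) \<times>\<^sub>Q (U \<Rightarrow>\<^sub>Q qprob X) \<and>
     kernel_prod Y X Z U
       \<in> (Z \<Rightarrow>\<^sub>Q qprob Y) \<times>\<^sub>Q (U \<Rightarrow>\<^sub>Q qprob X) \<rightarrow>\<^sub>Q (Z \<times>\<^sub>Q U \<Rightarrow>\<^sub>Q qprob (Y \<times>\<^sub>Q X)) \<and>
     precomp (U \<times>\<^sub>Q Z) (Z \<times>\<^sub>Q U) (qprob (Y \<times>\<^sub>Q X)) (swap_map U Z)
       \<in> (Z \<times>\<^sub>Q U \<Rightarrow>\<^sub>Q qprob (Y \<times>\<^sub>Q X)) \<rightarrow>\<^sub>Q (U \<times>\<^sub>Q Z \<Rightarrow>\<^sub>Q qprob (Y \<times>\<^sub>Q X)) \<and>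
     compose (pts ((U \<Rightarrow>\<^sub>Q qprob X) \<times>\<^sub>Q (Z \<Rightarrow>\<^sub>Q qprob Y)))
       (push_kernel (U \<times>\<^sub>Q Z) (X \<times>\<^sub>Q Y) (Y \<times>\<^sub>Q X) (swap_map X Y))
       (kernel_prod X Y U Z)
     = compose (pts ((U \<Rightarrow>\<^sub>Q qprob X) \<times>\<^sub>Q (Z \<Rightarrow>\<^sub>Q qprob Y)))
         (precomp (U \<times>\<^sub>Q Z) (Z \<times>\<^sub>Q U) (qprob (Y \<times>\<^sub>Q X)) (swap_map U Z))
         (compose (pts ((U \<Rightarrow>\<^sub>Q qprob X) \<times>\<^sub>Q (Z \<Rightarrow>\<^sub>Q qprob Y)))
           (kernel_prod Y X Z U)
           (swap_map (U \<Rightarrow>\<^sub>Q qprob X) (Z \<Rightarrow>\<^sub>Q qprob Y))) \<and>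
     (\<forall>K \<in> pts (U \<Rightarrow>\<^sub>Q qprob X). \<forall>Q \<in> pts (Z \<Rightarrow>\<^sub>Q qprob Y). \<forall>u \<in> pts U. \<forall>z \<in> pts Z.
      \<forall>f \<in> X \<times>\<^sub>Q Y \<rightarrow>\<^sub>Q ennreal_space.
        (\<integral>\<^sup>+ y. (\<integral>\<^sup>+ x. f (x, y) \<partial>K u) \<partial>Q z) = (\<integral>\<^sup>+ x. (\<integral>\<^sup>+ y. f (x, y) \<partial>Q z) \<partial>K u))"
proof (intro conjI ballI)
  note X = assms(1) and Y = assms(2) and U = assms(3) and Z = assms(4)
  note XY = quasi_universal_qprod[OF X Y] and YX = quasi_universal_qprod[OF Y X]
  note UZ = quasi_universal_qprod[OF U Z] and ZU = quasi_universal_qprod[OF Z U]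
  show "kernel_prod X Y U Z
       \<in> (U \<Rightarrow>\<^sub>Q qprob X) \<times>\<^sub>Q (Z \<Rightarrow>\<^sub>Q qprob Y) \<rightarrow>\<^sub>Q (U \<times>\<^sub>Q Z \<Rightarrow>\<^sub>Q qprob (X \<times>\<^sub>Q Y))"
    by (rule kernel_prod_qmeas[OF X Y U Z])
  show "kernel_prod Y X Z U
       \<in> (Z \<Rightarrow>\<^sub>Q qprob Y) \<times>\<^sub>Q (U \<Rightarrow>\<^sub>Q qprob X) \<rightarrow>\<^sub>Q (Z \<times>\<^sub>Q U \<Rightarrow>\<^sub>Q qprob (Y \<times>\<^sub>Q X))"
    by (rule kernel_prod_qmeas[OF Y X Z U])
  show "push_kernel (U \<times>\<^sub>Q Z) (X \<times>\<^sub>Q Y) (Y \<times>\<^sub>Q X) (swap_map X Y)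
       \<in> (U \<times>\<^sub>Q Z \<Rightarrow>\<^sub>Q qprob (X \<times>\<^sub>Q Y)) \<rightarrow>\<^sub>Q (U \<times>\<^sub>Q Z \<Rightarrow>\<^sub>Q qprob (Y \<times>\<^sub>Q X))"
    by (rule push_kernel_qmeas[OF UZ XY YX swap_map_qmeas[OF X Y]])
  show "swap_map (U \<Rightarrow>\<^sub>Q qprob X) (Z \<Rightarrow>\<^sub>Q qprob Y)
       \<in> (U \<Rightarrow>\<^sub>Q qprob X) \<times>\<^sub>Q (Z \<Rightarrow>\<^sub>Q qprob Y) \<rightarrow>\<^sub>Q (Z \<Rightarrow>\<^sub>Q qprob Y) \<times>\<^sub>Q (U \<Rightarrow>\<^sub>Q qprob X)"
    by (intro swap_map_qmeas quasi_universal_qexp quasi_universal_qprob X Y U Z)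
  show "precomp (U \<times>\<^sub>Q Z) (Z \<times>\<^sub>Q U) (qprob (Y \<times>\<^sub>Q X)) (swap_map U Z)
       \<in> (Z \<times>\<^sub>Q U \<Rightarrow>\<^sub>Q qprob (Y \<times>\<^sub>Q X)) \<rightarrow>\<^sub>Q (U \<times>\<^sub>Q Z \<Rightarrow>\<^sub>Q qprob (Y \<times>\<^sub>Q X))"
    by (rule precomp_qmeas[OF UZ ZU quasi_universal_qprob[OF YX] swap_map_qmeas[OF U Z]])
  show "compose (pts ((U \<Rightarrow>\<^sub>Q qprob X) \<times>\<^sub>Q (Z \<Rightarrow>\<^sub>Q qprob Y)))
       (push_kernel (U \<times>\<^sub>Q Z) (X \<times>\<^sub>Q Y) (Y \<times>\<^sub>Q X) (swap_map X Y))
       (kernel_prod X Y U Z)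
     = compose (pts ((U \<Rightarrow>\<^sub>Q qprob X) \<times>\<^sub>Q (Z \<Rightarrow>\<^sub>Q qprob Y)))
         (precomp (U \<times>\<^sub>Q Z) (Z \<times>\<^sub>Q U) (qprob (Y \<times>\<^sub>Q X)) (swap_map U Z))
         (compose (pts ((U \<Rightarrow>\<^sub>Q qprob X) \<times>\<^sub>Q (Z \<Rightarrow>\<^sub>Q qprob Y)))
           (kernel_prod Y X Z U)
           (swap_map (U \<Rightarrow>\<^sub>Q qprob X) (Z \<Rightarrow>\<^sub>Q qprob Y)))"
    (is "compose ?A ?f ?g = compose ?A ?h (compose ?A ?k ?s)")
  \<comment> \<open>Both composites are extensional on \<open>?A\<close>, so they are compared on
    pairs of kernels only.\<close>
  proof (rule extensionalityI[OF compose_extensional compose_extensional])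
    fix p assume p: "p \<in> ?A"
    then obtain K Q where KQ: "p = (K, Q)" "K \<in> U \<rightarrow>\<^sub>Q qprob X" "Q \<in> Z \<rightarrow>\<^sub>Q qprob Y"
      by auto
    then have "?s p = (Q, K)"
      by (simp add: swap_map_def)
    then have "compose ?A ?h (compose ?A ?k ?s) p = ?h (?k (Q, K))"
      by (simp only: compose_eq[OF p])
    moreover have "compose ?A ?f ?g p = ?f (?g (K, Q))"
      using KQ(1) by (metis compose_eq[OF p])
    ultimately show "compose ?A ?f ?g p = compose ?A ?h (compose ?A ?k ?s) p"
      by (simp only: kernel_prod_swap[OF X Y U Z KQ(2,3)])
  qed
  fix K Q u z f
  assume "K \<in> pts (U \<Rightarrow>\<^sub>Q qprob X)" "Q \<in> pts (Z \<Rightarrow>\<^sub>Q qprob Y)" "u \<in> pts U" "z \<in> pts Z"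
    and f: "f \<in> X \<times>\<^sub>Q Y \<rightarrow>\<^sub>Q ennreal_space"
  then have "K u \<in> pts (qprob X)" "Q z \<in> pts (qprob Y)"
    using PiE_mem[OF qmeas_PiE] by fastforce+
  then show "(\<integral>\<^sup>+ y. (\<integral>\<^sup>+ x. f (x, y) \<partial>K u) \<partial>Q z) = (\<integral>\<^sup>+ x. (\<integral>\<^sup>+ y. f (x, y) \<partial>Q z) \<partial>K u)"
    by (rule qprob_Fubini[OF X Y qmeas_ennreal_jointly_measurable[OF X Y f]])
qed

end
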